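(* Let $a$ be a non-negative integer with decimal digits $s_1$ (units), $s_2,\dots,s_n$. For $a$ coprime to $10$, let $l$ and $s_l$ be the position and the value of the key-digit of $a$ with respect to the decadic integer $\alpha_{x_2x_1}$ attached to the residue class of $a$ modulo $20$. It is taken into account that $n=1$ implies $s_2=0=s_l$, and that, if there is no pair $(x_2,x_1)$ of final digits of a solution of $y^5=y$ in $\mathbb{Z}_{10}$ with $x_2=s_2$ and $x_1=s_1$, then $V(a)=1$, for any $a$ not congruent to $0$ modulo $10$. The constant congruence speed of $a$ is given by $$V(a)=\begin{cases} 0 & \text{if } a\in\{0,1\},\\ v_5(a^2+1) & \text{if } a\equiv 2 \text{ or } 8\pmod{10},\\ v_5(a+1) & \text{if } a\equiv 4\pmod{10},\\ v_5(a-1) & \text{if } a\equiv 6\pmod{10},\\ v_2(a-1) & \text{if } a\equiv 5\pmod{20},\\ v_2(a+1) & \text{if } a\equiv 15\pmod{20},\\ v_5(a-1) & \text{if } a\equiv 1\pmod{20},\ s_l\neq 5,\ a\neq 1,\\ v_2(a-1) & \text{if } a\equiv 1\pmod{20},\ s_l=5,\\ v_5(a-1) & \text{if } a\equiv 11\pmod{20},\ |s_l-\alpha_{51}[l]|\neq 5,\\ v_2(a+1) & \text{if } a\equiv 11\pmod{20},\ |s_l-\alpha_{51}[l]|=5,\\ v_5(a^2+1) & \text{if } a\equiv 3\pmod{20},\ |s_l-\alpha_{43}[l]|\neq 5,\\ v_2(a+1) & \text{if } a\equiv 3\pmod{20},\ |s_l-\alpha_{43}[l]|=5,\\ v_5(a^2+1)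 & \text{if } a\equiv 13\pmod{20},\ |s_l-\alpha_{93}[l]|\neq 5,\\ v_2(a-1) & \text{if } a\equiv 13\pmod{20},\ |s_l-\alpha_{93}[l]|=5,\\ v_5(a^2+1) & \text{if } a\equiv 7\pmod{20},\ |s_l-\alpha_{07}[l]|\neq 5,\\ v_2(a+1) & \text{if } a\equiv 7\pmod{20},\ |s_l-\alpha_{07}[l]|=5,\\ v_5(a^2+1) & \text{if } a\equiv 17\pmod{20},\ |s_l-\alpha_{57}[l]|\neq 5,\\ v_2(a-1) & \text{if } a\equiv 17\pmod{20},\ |s_l-\alpha_{57}[l]|=5,\\ v_5(a+1) & \text{if } a\equiv 9\pmod{20},\ |s_l-\alpha_{49}[l]|\neq 5,\\ v_2(a-1) & \text{if } a\equiv 9\pmod{20},\ |s_l-\alpha_{49}[l]|=5,\\ v_5(a+1) & \text{if } a\equiv 19\pmod{20},\ s_l\neq 4,\\ v_2(a+1) & \text{if } a\equiv 19\pmod{20},\ s_l=4,\\ \emptyset\ (\text{no value}) & \text{if and only if } a\equiv 0\pmod{10},\ a\neq 0. \end{cases}$$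
   Context: For a prime $p$, $v_p$ denotes the $p$-adic valuation on $\mathbb{Z}$. For an integer $a\ge 1$, the tetration ${}^{b}a$ is defined by ${}^{1}a=a$ and ${}^{b}a=a^{({}^{b-1}a)}$ for $b\ge 2$. For an integer $a\ge 2$ not divisible by $10$ and $b\ge 1$, let $\#S(a,b)$ be the non-negative integer $n$ such that ${}^{b}a\equiv {}^{b+1}a \pmod{10^{n}}$ and ${}^{b}a\not\equiv {}^{b+1}a\pmod{10^{n+1}}$. The congruence speed of $a$ at height $b$ is $V(a,b):=\#S(a,b)-\#S(a,b-1)$ for $b\ge 2$ and $V(a,1):=\#S(a,1)$. It is known that $V(a,b)$ is constant for all sufficiently large $b$ (for instance for $b\ge a+1$); this eventual constant value is the constant congruence speed $V(a)$. By convention $V(0)=V(1)=0$. Decadic integers: $\mathbb{Z}_{10}$ is the ring of $10$-adic (decadic) integers. The equation $y^5=y$ has exactly fifteen solutions in $\mathbb{Z}_{10}$; each is determined by its rightmost digit $x_1$ and its second rightmost digit $x_2$ and is denoted $\alpha_{x_2x_1}$. They are $\alpha_{00}=0$, $\alpha_{01}=1$, $\alpha_{51}$, $\alpha_{32}$, $\alpha_{93}$, $\alpha_{43}$, $\alpha_{24}$, $\alpha_{25}$, $\alpha_{75}$, $\alpha_{76}$, $\alpha_{07}$, $\alpha_{57}$, $\alpha_{68}$, $\alpha_{49}$, $\alpha_{99}=-1=\dots 999$. The $m$-th rightmost digit of $\alpha_{x_2x_1}$ is denoted $\alpha_{x_2x_1}[m]\in\{0,\dots,9\}$. The decadic integer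 attached to the residue class of $a$ modulo $20$, for $a$ coprime to $10$, is: $\alpha_{01}$ for $1$, $\alpha_{51}$ for $11$, $\alpha_{43}$ for $3$, $\alpha_{93}$ for $13$, $\alpha_{07}$ for $7$, $\alpha_{57}$ for $17$, $\alpha_{49}$ for $9$, $\alpha_{99}$ for $19$. Key-digit: with the convention $s_j=0$ for $j>n$, the position $l\ge 2$ of the key-digit of $a$ with respect to $\alpha$ is the integer $l$ such that $a\equiv\alpha\pmod{10^{l-1}}$ and $a\not\equiv\alpha\pmod{10^{l}}$, i.e. the smallest index $l$ with $s_l\neq\alpha[l]$ (possibly $l>n$, in which case $s_l=0$); the key-digit is $s_l$. (For $a=1$ no such $l$ exists, and $s_l$ is taken to be $0$ by the convention for $n=1$.)
   Formalization: The remark that V(a)=1 when no pair of final digits of a solution of y^5=y equals (s_2,s_1) is stated only for a coprime to 10, not for all a not congruent to 0 mod 10; as written it fails, e.g. for a=5 (V=2) and a=26 (V=2). *)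

theory Defs
  imports "HOL-Number_Theory.Cong"
begin

section \<open>Tetration and congruence speed\<close>

text \<open>The value at height 0 is 1, so that the value at height 1 is \<open>a\<close>.\<close>

primrec tetration :: "nat \<Rightarrow> nat \<Rightarrow> nat" where
  "tetration a 0 = 1"
| "tetration a (Suc b) = a ^ tetration a b"

definition stable_digits :: "nat \<Rightarrow> nat \<Rightarrow> nat" where
  "stable_digits a b = (THE n.
     [tetration a b = tetration a (b + 1)] (mod 10 ^ n) \<and>
     \<not> [tetration a b = tetration a (b + 1)] (mod 10 ^ (n + 1)))"

text \<open>The difference is taken in the integers, so nothing is truncated.\<close>

definition congruence_speed :: "nat \<Rightarrow> nat \<Rightarrow> int" where
  "congruence_speed a b =
     (if b = 1 then int (stable_digits a 1)
      else int (stable_digits a b) - int (stable_digits a (b - 1)))"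

text \<open>
  \<open>None\<close> means that there is no value: the sequence of congruence speeds of \<open>a\<close> is not
  eventually constant. The formulas above also make sense for multiples of 10, where the
  speeds are unbounded, so multiples of 10 need no separate clause.
\<close>

definition constant_congruence_speed :: "nat \<Rightarrow> int option" where
  "constant_congruence_speed a =
     (if a = 0 \<or> a = 1 then Some 0
      else if \<exists>v. \<forall>\<^sub>F b in sequentially. congruence_speed a b = v
        then Some (THE v. \<forall>\<^sub>F b in sequentially. congruence_speed a b = v)
      else None)"

section \<open>The ring of decadic integers\<close>

text \<open>The inverse limit of the rings of integers modulo \<open>10 ^ n\<close>.\<close>

typedef decadic =
  "{x :: nat \<Rightarrow> int. \<forall>n. x n \<in> {0..<10 ^ n} \<and> x (Suc n) mod 10 ^ n = x n}"
  morphisms residue Abs_decadic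
  by (rule exI[of _ "\<lambda>_. 0"]) simp

setup_lifting type_definition_decadic

lemma mod_power_Suc_mod [simp]: "(k :: int) mod 10 ^ Suc n mod 10 ^ n = k mod 10 ^ n"
  by (rule mod_mod_cancel) simp

lemma residue_mod [simp]: "residue x n mod 10 ^ n = residue x n"
  using residue[of x] by (auto intro: mod_pos_pos_trivial)

lemma coherent_mod:
  fixes f :: "nat \<Rightarrow> int"
  assumes "\<And>n. f (Suc n) mod 10 ^ n = f n mod 10 ^ n"
  shows "f n mod 10 ^ n \<in> {0..<10 ^ n} \<and>
    (f (Suc n) mod 10 ^ Suc n) mod 10 ^ n = f n mod 10 ^ n"
  using assms by (simp only: mod_power_Suc_mod) simp

instantiation decadic :: comm_ring_1
begin

lift_definition zero_decadic :: decadic is "\<lambda>_. 0" by simp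

lift_definition one_decadic :: decadic is "\<lambda>n. 1 mod 10 ^ n"
  by (rule coherent_mod) simp

lift_definition plus_decadic :: "decadic \<Rightarrow> decadic \<Rightarrow> decadic"
  is "\<lambda>x y n. (x n + y n) mod 10 ^ n"
  by (rule coherent_mod) (metis mod_add_eq)

lift_definition minus_decadic :: "decadic \<Rightarrow> decadic \<Rightarrow> decadic"
  is "\<lambda>x y n. (x n - y n) mod 10 ^ n"
  by (rule coherent_mod) (metis mod_diff_eq)

lift_definition uminus_decadic :: "decadic \<Rightarrow> decadic"
  is "\<lambda>x n. (- x n) mod 10 ^ n"
  by (rule coherent_mod) (metis mod_minus_eq)

lift_definition times_decadic :: "decadic \<Rightarrow> decadic \<Rightarrow> decadic"
  is "\<lambda>x y n. (x n * y n) mod 10 ^ n"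
  by (rule coherent_mod) (metis mod_mult_eq)

instance
proof
  fix x y z :: decadic
  note eqI = residue_inject[THEN iffD1] ext
  note defs = zero_decadic.rep_eq one_decadic.rep_eq plus_decadic.rep_eq
    minus_decadic.rep_eq uminus_decadic.rep_eq times_decadic.rep_eq mod_simps
  show "x * y * z = x * (y * z)" by (rule eqI)+ (simp add: defs mult.assoc)
  show "x * y = y * x" by (rule eqI)+ (simp add: defs mult.commute)
  show "1 * x = x" by (rule eqI)+ (simp add: defs)
  show "x + y + z = x + (y + z)" by (rule eqI)+ (simp add: defs add.assoc)
  show "x + y = y + x" by (rule eqI)+ (simp add: defs add.commute)
  show "0 + x = x" by (rule eqI)+ (simp add: defs)
  show "- x + x = 0" by (rule eqI)+ (simp add: defs)
  show "x - y = x + - y" by (rule eqI)+ (simp add: defs)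
  show "(x + y) * z = x * z + y * z" by (rule eqI)+ (simp add: defs distrib_right)
  have "residue 0 1 \<noteq> residue 1 1" by (simp add: defs)
  then show "(0 :: decadic) \<noteq> 1" by metis
qed

end

text \<open>Digits are counted from the right, starting with \<open>m = 1\<close>.\<close>

definition decadic_digit :: "decadic \<Rightarrow> nat \<Rightarrow> int" where
  "decadic_digit x m = residue x m div 10 ^ (m - 1)"

definition decimal_digit :: "nat \<Rightarrow> nat \<Rightarrow> int" where
  "decimal_digit a m = int (a div 10 ^ (m - 1) mod 10)"

definition alpha :: "int \<Rightarrow> int \<Rightarrow> decadic" where
  "alpha x2 x1 = (THE y. y ^ 5 = y \<and> decadic_digit y 2 = x2 \<and> decadic_digit y 1 = x1)"

definition attached_decadic :: "nat \<Rightarrow> decadic" where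
  "attached_decadic a =
     (if [a = 1] (mod 20) then alpha 0 1
      else if [a = 11] (mod 20) then alpha 5 1
      else if [a = 3] (mod 20) then alpha 4 3
      else if [a = 13] (mod 20) then alpha 9 3
      else if [a = 7] (mod 20) then alpha 0 7
      else if [a = 17] (mod 20) then alpha 5 7
      else if [a = 9] (mod 20) then alpha 4 9
      else if [a = 19] (mod 20) then alpha 9 9
      else undefined)"

section \<open>The key-digit\<close>

text \<open>Congruence modulo \<open>10 ^ k\<close> is divisibility of the difference in the decadic integers.\<close>

definition is_key_position :: "nat \<Rightarrow> decadic \<Rightarrow> nat \<Rightarrow> bool" where
  "is_key_position a x l \<longleftrightarrow>
     l \<ge> 2 \<and> 10 ^ (l - 1) dvd of_nat a - x \<and> \<not> 10 ^ l dvd of_nat a - x"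

definition key_position :: "nat \<Rightarrow> decadic \<Rightarrow> nat" where
  "key_position a x = (THE l. is_key_position a x l)"

text \<open>The value 0 in the absence of a key position is the convention for \<open>a = 1\<close>.\<close>

definition key_digit :: "nat \<Rightarrow> decadic \<Rightarrow> int" where
  "key_digit a x =
     (if \<exists>l. is_key_position a x l then decimal_digit a (key_position a x) else 0)"

end

theory Submission
  imports Defs
begin

text \<open>
  Let \<open>D b\<close> be the difference of the tetrations of \<open>a\<close> at heights \<open>b + 1\<close> and \<open>b\<close>. Then
  \<open>D (b + 1) = a ^ T * (a ^ D b - 1)\<close>, where \<open>T\<close> is the tetration at height \<open>b\<close>. If a prime
  \<open>p \<in> {2, 5}\<close> does not divide \<open>a\<close>, lifting the exponent shows that the valuation of \<open>D b\<close> at \<open>p\<close>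
  grows linearly in \<open>b\<close>: with slope \<open>w\<close>, the valuation of \<open>a ^ 4 - 1\<close>, for \<open>p = 5\<close>, and with slope
  \<open>u\<close>, the valuation of \<open>a - \<epsilon>\<close>, for \<open>p = 2\<close>, where \<open>\<epsilon>\<close> is the sign with \<open>a \<equiv> \<epsilon>\<close> modulo 4. If
  \<open>p\<close> divides \<open>a\<close>, the valuation grows at least exponentially. Hence the constant congruence speed
  is the least slope over the primes not dividing \<open>a\<close>; if there are none, the speeds are unbounded.

  For \<open>a\<close> coprime to 10, the attached decadic integer is \<open>\<epsilon>\<close> in the 2-adic and the Teichmueller
  representative of \<open>a\<close> in the 5-adic integers. So \<open>a\<close> agrees with it modulo \<open>10 ^ k\<close> exactly if
  \<open>k \<le> min u w\<close>: the key digit is at position \<open>min u w + 1\<close>, and there the two digits agree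
  modulo 5, i.e. differ by exactly 5, if and only if \<open>u < w\<close>.
\<close>

section \<open>Lifting the exponent\<close>

lemma multiplicity_mult_not_dvd:
  fixes p :: int
  assumes "prime p" "\<not> p dvd y"
  shows "multiplicity p (x * y) = multiplicity p x"
proof (cases "x = 0")
  case False
  then show ?thesis
    using assms by (subst prime_elem_multiplicity_mult_distrib) (auto simp: not_dvd_imp_multiplicity_0)
qed simp

lemma multiplicity_prime_mult_not_dvd:
  fixes p :: int
  assumes "prime p" "\<not> p dvd y" "x \<noteq> 0"
  shows "multiplicity p (x * (p * y)) = Suc (multiplicity p x)"
proof -
  have "multiplicity p (x * (p * y)) = multiplicity p (p * x * y)"
    by (simp add: ac_simps)
  also have "\<dots> = multiplicity p (p * x)"
    using assms by (intro multiplicity_mult_not_dvd)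
  also have "\<dots> = Suc (multiplicity p x)"
    using assms not_prime_unit by (intro multiplicity_times_same) auto
  finally show ?thesis .
qed

text \<open>Binomial expansion around 1: every term from the second order on carries
  \<open>(x - 1) ^ 2\<close>, which \<open>p ^ 2\<close> divides.\<close>

lemma power_cong_linear_mod_square:
  fixes x p :: int
  assumes "p dvd x - 1"
  shows "[x ^ i = 1 + int i * (x - 1)] (mod p\<^sup>2)"
proof (induction i)
  case (Suc i)
  have sq: "p\<^sup>2 dvd (x - 1)\<^sup>2" using assms by simp
  have "[x ^ Suc i = (1 + int i * (x - 1)) * x] (mod p\<^sup>2)"
    using cong_scalar_right[OF Suc.IH, of x] by (simp add: mult.commute)
  also have "[(1 + int i * (x - 1)) * x = 1 + int (Suc i) * (x - 1)] (mod p\<^sup>2)"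
  proof -
    have "(1 + int i * (x - 1)) * x - (1 + int (Suc i) * (x - 1)) = int i * (x - 1)\<^sup>2"
      by (simp add: algebra_simps power2_eq_square)
    then show ?thesis using sq by (simp add: cong_iff_dvd_diff)
  qed
  finally show ?case .
qed simp

text \<open>Modulo \<open>p ^ 2\<close> the sum is \<open>p\<close> plus \<open>x - 1\<close> times
  the triangular number \<open>p * (p - 1) / 2\<close>. For odd \<open>p\<close> both factors
  contain \<open>p\<close>; for \<open>p = 2\<close> the triangular number is 1, so
  \<open>x - 1\<close> has to supply the 4 by itself. Hence \<open>p\<close> divides the sum exactly
  once.\<close>

lemma geometric_sum_prime:
  fixes x :: int and p :: nat
  assumes "prime p" "int p dvd x - 1" "p = 2 \<Longrightarrow> 4 dvd x - 1"
  obtains k where "(\<Sum>i<p. x ^ i) = int p * (1 + int p * k)"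
proof -
  have "[(\<Sum>i<p. x ^ i) = (\<Sum>i<p. 1 + int i * (x - 1))] (mod (int p)\<^sup>2)"
    using assms(2) by (intro cong_sum power_cong_linear_mod_square)
  also have "(\<Sum>i<p. 1 + int i * (x - 1)) = int p + (\<Sum>i<p. int i) * (x - 1)"
    by (simp add: sum.distrib sum_distrib_right)
  also have "[\<dots> = int p] (mod (int p)\<^sup>2)"
  proof -
    have "(int p)\<^sup>2 dvd (\<Sum>i<p. int i) * (x - 1)"
    proof (cases "p = 2")
      case True
      then show ?thesis using assms(3) by (simp add: numeral_2_eq_2 lessThan_Suc)
    next
      case False
      with assms(1) have "odd p" using primes_dvd_imp_eq two_is_prime_nat by blast
      then obtain m where m: "p = 2 * m + 1" by (elim oddE)
      have "2 * (\<Sum>i<p. int i) = int p * (int p - 1)"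
        by (induction p) (auto simp: algebra_simps)
      with m have "(\<Sum>i<p. int i) = int p * int m" by simp
      then show ?thesis using assms(2) by (simp add: power2_eq_square mult_dvd_mono)
    qed
    then show ?thesis by (simp add: cong_iff_dvd_diff)
  qed
  finally have "(int p)\<^sup>2 dvd (\<Sum>i<p. x ^ i) - int p" by (simp add: cong_iff_dvd_diff)
  then obtain k where "(\<Sum>i<p. x ^ i) - int p = (int p)\<^sup>2 * k" by (elim dvdE)
  then have "(\<Sum>i<p. x ^ i) = int p * (1 + int p * k)"
    by (simp add: algebra_simps power2_eq_square)
  then show thesis by (rule that)
qed

lemma geometric_sum_cong:
  fixes x p :: int
  assumes "p dvd x - 1"
  shows "[(\<Sum>i<n. x ^ i) = int n] (mod p)"
proof -
  have "[x = 1] (mod p)" using assms by (simp add: cong_iff_dvd_diff)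
  then have "[(\<Sum>i<n. x ^ i) = (\<Sum>i<n. 1 ^ i)] (mod p)"
    by (intro cong_sum cong_pow)
  then show ?thesis by simp
qed

text \<open>Write \<open>n = p ^ k * m\<close> with \<open>p\<close> not dividing \<open>m\<close>.
  Each \<open>p\<close>-th power multiplies the difference from 1 by a geometric sum containing
  \<open>p\<close> exactly once; the final \<open>m\<close>-th power multiplies it by a sum
  congruent to \<open>m\<close>, which is prime to \<open>p\<close>.\<close>

lemma lifting_the_exponent:
  fixes x :: int and p :: nat
  assumes p: "prime p" and "int p dvd x - 1" "p = 2 \<Longrightarrow> 4 dvd x - 1" "x \<noteq> 1" "n > 0"
  shows "multiplicity (int p) (x ^ n - 1) = multiplicity (int p) (x - 1) + multiplicity (int p) (int n)"
proof -
  have ip: "prime (int p)" using p by simp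
  \<comment> \<open>Being different from 1 is carried through the induction, since the multiplicity
    in 0 is 0 by default and would not grow.\<close>
  have pp: "multiplicity (int p) (x ^ (p ^ k) - 1) = multiplicity (int p) (x - 1) + k
      \<and> x ^ (p ^ k) \<noteq> 1" for k
  proof (induction k)
    case (Suc k)
    define y where "y = x ^ (p ^ k)"
    have dvd: "x - 1 dvd y - 1"
      unfolding y_def by (simp add: power_diff_1_eq)
    obtain c where c: "(\<Sum>i<p. y ^ i) = int p * (1 + int p * c)"
      using geometric_sum_prime[of p y] assms dvd by (meson dvd_trans)
    have nd: "\<not> int p dvd 1 + int p * c"
      using p not_prime_1 by (auto simp add: dvd_add_left_iff)
    have "x ^ (p ^ Suc k) - 1 = (y - 1) * (int p * (1 + int p * c))"
      unfolding c[symmetric] power_diff_1_eq[symmetric] y_def by (simp add: mult.commute flip: power_mult)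
    moreover have "y \<noteq> 1" "multiplicity (int p) (y - 1) = multiplicity (int p) (x - 1) + k"
      using Suc.IH by (auto simp: y_def)
    ultimately show ?case
      using multiplicity_prime_mult_not_dvd[OF ip nd, of "y - 1"] nd p
      by (auto simp: prime_gt_0_nat)
  qed (use assms in auto)
  obtain m where m: "n = p ^ multiplicity p n * m" "\<not> p dvd m"
  proof -
    have "n \<noteq> 0" "\<not> is_unit p" using assms not_prime_unit by auto
    then show ?thesis using multiplicity_decompose' that by blast
  qed
  define k where "k = multiplicity p n"
  define y where "y = x ^ (p ^ k)"
  have dvd: "x - 1 dvd y - 1"
    unfolding y_def by (simp add: power_diff_1_eq)
  have "[(\<Sum>i<m. y ^ i) = int m] (mod int p)"
    using dvd_trans[OF assms(2) dvd] by (rule geometric_sum_cong)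
  then have nd: "\<not> int p dvd (\<Sum>i<m. y ^ i)"
    using m(2) by (simp add: cong_dvd_iff)
  have "x ^ n = y ^ m"
    unfolding y_def k_def power_mult[symmetric] using m(1) by (rule arg_cong)
  then have "x ^ n - 1 = (y - 1) * (\<Sum>i<m. y ^ i)"
    using power_diff_1_eq[of y m] by simp
  then have "multiplicity (int p) (x ^ n - 1) = multiplicity (int p) (y - 1)"
    using multiplicity_mult_not_dvd[OF ip nd] by simp
  also have "\<dots> = multiplicity (int p) (x - 1) + k" using pp by (simp add: y_def)
  also have "k = multiplicity (int p) (int n)"
  proof (rule multiplicity_decomposeI[symmetric])
    show "int n = int p ^ k * int m"
      using m(1) by (metis k_def of_nat_mult of_nat_power)
  qed (use m(2) p in auto)
  finally show ?thesis .
qed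

section \<open>Gaps between successive tetrations\<close>

text \<open>For \<open>a \<ge> 2\<close> the tetrations increase, so the natural subtraction
  truncates nothing.\<close>

definition tetration_gap :: "nat \<Rightarrow> nat \<Rightarrow> nat" where
  "tetration_gap a b = tetration a (Suc b) - tetration a b"

lemma less_power_self:
  fixes a n :: nat
  assumes "a \<ge> 2"
  shows "n < a ^ n"
  using less_le_trans[OF less_exp power_mono[OF assms]] by simp

lemma tetration_less_Suc: "a \<ge> 2 \<Longrightarrow> tetration a b < tetration a (Suc b)"
  by (simp add: less_power_self)

lemma tetration_gap_pos: "a \<ge> 2 \<Longrightarrow> tetration_gap a b > 0"
  using tetration_less_Suc[of a b] by (simp add: tetration_gap_def)

lemma tetration_gap_Suc:
  assumes "a \<ge> 2"
  shows "tetration_gap a (Suc b) = a ^ tetration a b * (a ^ tetration_gap a b - 1)"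
proof -
  have "tetration a (Suc b) = tetration a b + tetration_gap a b"
    using tetration_less_Suc[OF assms, of b] by (simp add: tetration_gap_def)
  then have "a ^ tetration a (Suc b) = a ^ tetration a b * a ^ tetration_gap a b"
    by (metis power_add)
  then show ?thesis
    by (simp add: tetration_gap_def diff_mult_distrib2)
qed

lemma int_tetration_gap_Suc:
  assumes "a \<ge> 2"
  shows "int (tetration_gap a (Suc b)) = int a ^ tetration a b * (int a ^ tetration_gap a b - 1)"
  using assms by (simp add: tetration_gap_Suc of_nat_diff)

lemma Suc_le_tetration: "a \<ge> 2 \<Longrightarrow> Suc b \<le> tetration a b"
proof (induction b)
  case (Suc b)
  then show ?case using tetration_less_Suc[of a b] by simp
qed simp

text \<open>With \<open>D\<close> the gap and \<open>T\<close> the tetration at height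
  \<open>b\<close>, the factor \<open>a ^ D - 1\<close> is at least \<open>D\<close> and the factor
  \<open>a ^ T\<close> at least 2, so the gap at least doubles. This rules out constant speeds for
  multiples of 10.\<close>

lemma tetration_gap_strict_mono:
  assumes "a \<ge> 2"
  shows "tetration_gap a b < tetration_gap a (Suc b)"
proof -
  have pos: "tetration_gap a b \<ge> 1" using tetration_gap_pos[OF assms, of b] by simp
  have "tetration_gap a b < a ^ tetration_gap a b"
    using assms by (rule less_power_self)
  then have "tetration_gap a b \<le> a ^ tetration_gap a b - 1" by simp
  moreover have "2 \<le> a ^ tetration a b"
    using self_le_power[of a "tetration a b"] Suc_le_tetration[of a b] assms by simp
  ultimately have "2 * tetration_gap a b \<le> tetration_gap a (Suc b)"
    unfolding tetration_gap_Suc[OF assms] by (intro mult_le_mono)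
  with pos show ?thesis by simp
qed

lemma two_power_le_tetration: "a \<ge> 2 \<Longrightarrow> 2 ^ b \<le> tetration a b"
proof (induction b)
  case (Suc b)
  have "(2::nat) ^ Suc b \<le> 2 ^ tetration a b"
    using Suc_le_tetration[of a b] Suc.prems by (intro power_increasing) auto
  also have "\<dots> \<le> a ^ tetration a b" using Suc.prems by (intro power_mono) auto
  finally show ?case by simp
qed simp

section \<open>Stable digits as the smaller of two valuations\<close>

lemma power_10_dvd_iff:
  fixes x :: int
  shows "10 ^ n dvd x \<longleftrightarrow> 2 ^ n dvd x \<and> 5 ^ n dvd x"
proof -
  have "coprime ((2::int) ^ n) (5 ^ n)" by simp
  moreover have "(10::int) ^ n = 2 ^ n * 5 ^ n" by (simp flip: power_mult_distrib)
  ultimately show ?thesis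
    by (metis divides_mult dvd_mult_left dvd_mult_right)
qed

text \<open>Divisibility of the gap by \<open>10 ^ n\<close> splits into powers of 2 and 5, so it
  holds exactly for \<open>n\<close> up to the minimum, and the minimum is the only \<open>n\<close>
  that works while its successor fails. The gap is nonzero, so the valuations are genuine.\<close>

lemma stable_digits_eq:
  assumes "a \<ge> 2"
  shows "stable_digits a b =
    min (multiplicity 2 (int (tetration_gap a b))) (multiplicity 5 (int (tetration_gap a b)))"
    (is "_ = ?m")
proof -
  let ?D = "int (tetration_gap a b)"
  have D: "?D \<noteq> 0" using tetration_gap_pos[OF assms, of b] by simp
  have "[tetration a b = tetration a (b + 1)] (mod 10 ^ n) \<longleftrightarrow> n \<le> ?m" for n
  proof -
    have "[tetration a b = tetration a (b + 1)] (mod 10 ^ n) \<longleftrightarrow> 10 ^ n dvd tetration_gap a b"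
      using tetration_less_Suc[OF assms, of b]
      by (subst cong_sym_eq) (simp add: tetration_gap_def cong_altdef_nat del: tetration.simps)
    also have "\<dots> \<longleftrightarrow> (10::int) ^ n dvd ?D"
      by (metis of_nat_dvd_iff of_nat_numeral of_nat_power)
    also have "\<dots> \<longleftrightarrow> n \<le> ?m"
      using D by (simp add: power_10_dvd_iff power_dvd_iff_le_multiplicity)
    finally show ?thesis .
  qed
  then show ?thesis
    unfolding stable_digits_def by (simp del: tetration.simps power_Suc min.bounded_iff) (rule the_equality, linarith+)
qed

lemma constant_congruence_speed_eqI:
  assumes "a \<ge> 2" and "\<And>b. b \<ge> B \<Longrightarrow> stable_digits a (Suc b) = stable_digits a b + v"
  shows "constant_congruence_speed a = Some (int v)"
proof -
  have ev: "\<forall>\<^sub>F b in sequentially. congruence_speed a b = int v"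
    unfolding eventually_sequentially
  proof (intro exI allI impI)
    \<comment> \<open>From \<open>B + 2\<close> on the height is never 1, where the speed has its
      own clause, and the preceding height is still at least \<open>B\<close>.\<close>
    fix b assume b: "b \<ge> B + 2"
    then have "stable_digits a b = stable_digits a (b - 1) + v"
      using assms(2)[of "b - 1"] by simp
    then show "congruence_speed a b = int v" using b by (simp add: congruence_speed_def)
  qed
  moreover have "w = int v" if "\<forall>\<^sub>F b in sequentially. congruence_speed a b = w" for w
    using eventually_happens[OF eventually_conj[OF that ev]] by auto
  ultimately have "(THE w. \<forall>\<^sub>F b in sequentially. congruence_speed a b = w) = int v"
    by (intro the_equality)
  with ev show ?thesis using assms(1) by (auto simp: constant_congruence_speed_def)
qed

section \<open>Comparison of linear and exponential growth\<close>

text \<open>In every step \<open>g\<close> gains at least 1 on \<open>f\<close>, so a head start of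
  \<open>f B\<close> is used up after \<open>f B\<close> steps.\<close>

lemma linear_eventually_le:
  fixes f g :: "nat \<Rightarrow> nat"
  assumes f: "\<And>b. b \<ge> B \<Longrightarrow> f (Suc b) = f b + u"
    and g: "\<And>b. b \<ge> B \<Longrightarrow> g (Suc b) = g b + w" and "u < w"
  shows "\<exists>N. \<forall>b\<ge>N. f b \<le> g b"
proof (intro exI allI impI)
  fix b assume b: "b \<ge> B + f B"
  define k where "k = b - B"
  have bk: "b = B + k" "f B \<le> k" using b by (auto simp: k_def)
  have "f (B + k) = f B + k * u" "g (B + k) = g B + k * w" for k
    using f g by (induction k) auto
  moreover have "k * Suc u \<le> k * w" using assms(3) by (intro mult_le_mono2) simp
  ultimately show "f b \<le> g b" using bk by simp
qed

text \<open>With different slopes, the slower function is eventually the minimum at both heights;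
  with equal slopes, both arguments of the minimum move by the same amount.\<close>

lemma min_linear_eventually_linear:
  fixes f g :: "nat \<Rightarrow> nat"
  assumes f: "\<And>b. b \<ge> B \<Longrightarrow> f (Suc b) = f b + u"
    and g: "\<And>b. b \<ge> B \<Longrightarrow> g (Suc b) = g b + w"
  shows "\<exists>N. \<forall>b\<ge>N. min (f (Suc b)) (g (Suc b)) = min (f b) (g b) + min u w"
proof -
  consider "u < w" | "w < u" | "u = w" by linarith
  then show ?thesis
  proof cases
    case 1
    then obtain N where N: "\<And>b. b \<ge> N \<Longrightarrow> f b \<le> g b" using linear_eventually_le[of B f u g w] f g by blast
    then have "min (f (Suc b)) (g (Suc b)) = min (f b) (g b) + min u w" if "b \<ge> max B N" for b
      using 1 f[of b] N[of b] N[of "Suc b"] that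
      by (simp add: min_absorb1)
    then show ?thesis by blast
  next
    case 2
    then obtain N where N: "\<And>b. b \<ge> N \<Longrightarrow> g b \<le> f b" using linear_eventually_le[of B g w f u] f g by blast
    then have "min (f (Suc b)) (g (Suc b)) = min (f b) (g b) + min u w" if "b \<ge> max B N" for b
      using 2 g[of b] N[of b] N[of "Suc b"] that by (simp add: min_absorb2)
    then show ?thesis by blast
  next
    case 3
    with f g show ?thesis by (intro exI[of _ B]) (simp add: min_add_distrib_left)
  qed
qed

text \<open>Compare through \<open>c * (b + 1)\<close>. The shift by one height matches the lower
  bound \<open>2 ^ b\<close> for the valuation at height \<open>b + 1\<close> when the prime divides
  \<open>a\<close>.\<close>

lemma linear_eventually_le_power:
  fixes f :: "nat \<Rightarrow> nat"
  assumes "\<And>b. b \<ge> B \<Longrightarrow> f (Suc b) = f b + u"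
  shows "\<exists>N. \<forall>b\<ge>N. f (Suc b) \<le> 2 ^ b"
proof -
  \<comment> \<open>This \<open>c\<close> dominates both the initial value \<open>f B\<close> and
    the increment \<open>u\<close>.\<close>
  define c where "c = B + f B + 2 * u + 2"
  have "f b \<le> c * Suc b" if "b \<ge> B" for b
    using that
  proof (induction b rule: dec_induct)
    case (step b)
    then show ?case using assms[of b] by (simp add: c_def)
  qed (simp add: c_def)
  moreover have "c * (b + 2) \<le> 2 ^ b" if "b \<ge> 2 * c + 2" for b
  proof -
    obtain d where b: "b = 2 * c + 2 + d" using le_Suc_ex[OF \<open>b \<ge> 2 * c + 2\<close>] by blast
    have "c * (2 * c + 2 + d + 2) \<le> 2 ^ (2 * c + 2 + d)"
    proof (induction d)
      case 0
      \<comment> \<open>Here \<open>2 ^ (2 * c + 2)\<close> is 4 times the square of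
        \<open>2 ^ c\<close>, so it is enough to square this inequality.\<close>
      have "c + 1 \<le> 2 ^ c" using less_power_self[of 2 c] by linarith
      then have "(c + 1) * (c + 1) \<le> 2 ^ c * 2 ^ c" by (intro mult_le_mono)
      then have "2 * (c * c) + 4 * c \<le> 4 * (2 ^ c * 2 ^ c)" by (simp add: algebra_simps)
      moreover have "2 ^ c * 2 ^ c = (2::nat) ^ (2 * c)" by (simp add: mult_2 power_add)
      ultimately show ?case by (simp add: algebra_simps)
    next
      case (Suc d)
      then show ?case by (simp add: algebra_simps)
    qed
    then show ?thesis by (simp only: b)
  qed
  ultimately have "f (Suc b) \<le> 2 ^ b" if "b \<ge> max B (2 * c + 2)" for b
    using that by (metis add_2_eq_Suc' le_SucI max.boundedE order_trans)
  then show ?thesis by blast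
qed

section \<open>The constant congruence speed\<close>

lemma even_tetration_gap:
  assumes "odd a" "a \<ge> 2"
  shows "even (tetration_gap a b)"
proof -
  have "odd (tetration a b)" for b using assms(1) by (cases b) auto
  then show ?thesis using tetration_less_Suc[OF assms(2), of b]
    by (simp add: tetration_gap_def del: tetration.simps)
qed

text \<open>For \<open>x = 2 * y + 1\<close>, \<open>x ^ 2 - 1\<close> is 4 times the even number
  \<open>y * (y + 1)\<close>, and it divides \<open>x ^ n - 1\<close>.\<close>

lemma eight_dvd_odd_power_minus_one:
  fixes x :: int
  assumes "odd x" "even n"
  shows "8 dvd x ^ n - 1"
proof -
  obtain y where y: "x = 2 * y + 1" using assms(1) by (elim oddE)
  obtain m where m: "n = 2 * m" using assms(2) by (elim evenE)
  have "even (y * (y + 1))" by simp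
  then obtain z where "y * (y + 1) = 2 * z" by (elim evenE)
  then have "x\<^sup>2 - 1 = 8 * z" by (simp add: y power2_eq_square algebra_simps)
  moreover have "x\<^sup>2 - 1 dvd x ^ n - 1"
    unfolding m power_mult by (simp add: power_diff_1_eq[of "x\<^sup>2"])
  ultimately show ?thesis by (metis dvd_trans dvd_triv_left)
qed

text \<open>With a multiple of 4 as exponent, a power of \<open>a\<close> becomes a power of
  \<open>a ^ 4\<close>, which is 1 modulo 5 unless 5 divides \<open>a\<close>. For odd
  \<open>a\<close> the previous gap is even; for even \<open>a\<close> the factor
  \<open>a ^ T\<close> with \<open>T \<ge> 2\<close> supplies the 4. Height 1 is too low: for
  \<open>a = 2\<close> the gap there is 2.\<close>

lemma four_dvd_tetration_gap:
  assumes "a \<ge> 2" "b \<ge> 2"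
  shows "4 dvd tetration_gap a b"
proof -
  obtain c where b: "b = Suc c" "c \<ge> 1" using assms(2) by (cases b) auto
  have "4 dvd int (tetration_gap a b)"
  proof (cases "odd a")
    case True
    then have "8 dvd int a ^ tetration_gap a c - 1"
      using even_tetration_gap assms(1) by (intro eight_dvd_odd_power_minus_one) auto
    then have "(4::int) dvd int a ^ tetration_gap a c - 1"
      by (rule dvd_trans[rotated]) simp
    then show ?thesis unfolding b int_tetration_gap_Suc[OF assms(1)] by (rule dvd_mult)
  next
    case False
    then have "2 ^ 2 dvd int a ^ 2" by (intro dvd_power_same) auto
    moreover have "2 \<le> tetration a c" using Suc_le_tetration[OF assms(1), of c] b(2) by linarith
    then have "int a ^ 2 dvd int a ^ tetration a c" by (rule le_imp_power_dvd)
    ultimately have "(4::int) dvd int a ^ tetration a c" by (simp add: dvd_trans)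
    then show ?thesis unfolding b int_tetration_gap_Suc[OF assms(1)] by (rule dvd_mult2)
  qed
  then show ?thesis by presburger
qed

section \<open>Growth of the valuations from one height to the next\<close>

lemma multiplicity_tetration_gap_Suc_coprime:
  assumes "a \<ge> 2" "prime p" "\<not> p dvd int a"
  shows "multiplicity p (int (tetration_gap a (Suc b))) = multiplicity p (int a ^ tetration_gap a b - 1)"
  unfolding int_tetration_gap_Suc[OF assms(1)] mult.commute[of "int a ^ _"]
  using assms by (intro multiplicity_mult_not_dvd) (auto dest: prime_dvd_power)

text \<open>The exponent is even, so the base \<open>a\<close> may be replaced by
  \<open>\<epsilon> * a\<close>, which is 1 modulo 4 as lifting the exponent at 2 demands.\<close>

lemma multiplicity_2_tetration_gap_Suc:
  assumes "a \<ge> 2" "odd a" "\<epsilon> \<in> {1, -1}" "4 dvd int a - \<epsilon>"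
  shows "multiplicity 2 (int (tetration_gap a (Suc b))) =
    multiplicity 2 (int (tetration_gap a b)) + multiplicity 2 (int a - \<epsilon>)"
proof -
  have ev: "even (tetration_gap a b)" using even_tetration_gap assms by blast
  have eq: "int a ^ tetration_gap a b = (\<epsilon> * int a) ^ tetration_gap a b"
    using ev assms(3) by auto
  have eps: "\<epsilon> * int a - 1 = \<epsilon> * (int a - \<epsilon>)" using assms(3) by (auto simp: algebra_simps)
  have dvd: "4 dvd \<epsilon> * int a - 1" unfolding eps using assms(4) by (rule dvd_mult)
  have "multiplicity 2 (int (tetration_gap a (Suc b))) = multiplicity 2 ((\<epsilon> * int a) ^ tetration_gap a b - 1)"
    unfolding eq[symmetric] using assms by (intro multiplicity_tetration_gap_Suc_coprime) auto
  also have "\<dots> = multiplicity 2 (\<epsilon> * int a - 1) + multiplicity 2 (int (tetration_gap a b))"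
    using lifting_the_exponent[of 2 "\<epsilon> * int a" "tetration_gap a b"] dvd assms(1,3)
      tetration_gap_pos[OF assms(1), of b] dvd_trans[of 2 4 "\<epsilon> * int a - 1"] by auto
  also have "multiplicity 2 (\<epsilon> * int a - 1) = multiplicity 2 (int a - \<epsilon>)"
    unfolding eps using assms(3) by (intro multiplicity_times_unit_right) auto
  finally show ?thesis by simp
qed

lemma five_dvd_fourth_power_minus_one:
  fixes x :: int
  assumes "\<not> 5 dvd x"
  shows "5 dvd x ^ 4 - 1"
proof -
  have "[x = 1] (mod 5) \<or> [x = 2] (mod 5) \<or> [x = 3] (mod 5) \<or> [x = 4] (mod 5)"
    using assms by (simp add: cong_def) presburger
  then have "[x ^ 4 = 1] (mod 5)"
    by (elim disjE; drule_tac n = 4 in cong_pow) (simp_all add: cong_def)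
  then show ?thesis by (simp add: cong_iff_dvd_diff)
qed

text \<open>Lifting the exponent with base \<open>a ^ 4\<close> and a quarter of the gap as
  exponent; quartering does not affect the valuation at 5.\<close>

lemma multiplicity_5_tetration_gap_Suc:
  assumes "a \<ge> 2" "\<not> 5 dvd a" "b \<ge> 2"
  shows "multiplicity 5 (int (tetration_gap a (Suc b))) =
    multiplicity 5 (int (tetration_gap a b)) + multiplicity 5 (int a ^ 4 - 1)"
proof -
  have nd: "\<not> 5 dvd int a" using assms(2) by presburger
  have ne: "int a ^ 4 \<noteq> 1" using assms(1) one_less_power[of "int a" 4] by linarith
  obtain m where m: "tetration_gap a b = 4 * m"
    using four_dvd_tetration_gap assms by blast
  have "m > 0" using m tetration_gap_pos[OF assms(1), of b] by simp
  have "multiplicity 5 (int (tetration_gap a (Suc b))) = multiplicity 5 ((int a ^ 4) ^ m - 1)"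
    using multiplicity_tetration_gap_Suc_coprime[OF assms(1) _ nd, of b] by (simp add: m power_mult)
  also have "\<dots> = multiplicity 5 (int a ^ 4 - 1) + multiplicity 5 (int m)"
    using lifting_the_exponent[of 5 "int a ^ 4" m] five_dvd_fourth_power_minus_one[OF nd] ne \<open>m > 0\<close>
    by simp
  also have "multiplicity 5 (int m) = multiplicity 5 (int (tetration_gap a b))"
    using multiplicity_mult_not_dvd[of 5 4 "int m"] by (simp add: m mult.commute)
  finally show ?thesis by simp
qed

text \<open>As \<open>p\<close> divides the positive power of \<open>a\<close> by the gap, it does
  not divide that power minus 1. The whole valuation comes from the other factor, the power of
  \<open>a\<close> by its tetration.\<close>

lemma multiplicity_tetration_gap_Suc_dvd:
  fixes p :: int
  assumes "a \<ge> 2" "prime p" "p dvd int a"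
  shows "multiplicity p (int (tetration_gap a (Suc b))) = tetration a b * multiplicity p (int a)"
proof -
  have "p dvd int a ^ tetration_gap a b"
    using assms(3) tetration_gap_pos[OF assms(1), of b] by (simp add: dvd_power_same dvd_trans dvd_power)
  then have "\<not> p dvd int a ^ tetration_gap a b - 1"
    using assms(2) not_prime_unit[of p] dvd_diff[of p "int a ^ tetration_gap a b" "int a ^ tetration_gap a b - 1"]
    by auto
  then have "multiplicity p (int (tetration_gap a (Suc b))) = multiplicity p (int a ^ tetration a b)"
    unfolding int_tetration_gap_Suc[OF assms(1)] by (rule multiplicity_mult_not_dvd[OF assms(2)])
  also have "\<dots> = tetration a b * multiplicity p (int a)"
    using assms by (intro prime_elem_multiplicity_power_distrib) auto
  finally show ?thesis .
qed

lemma two_power_le_multiplicity_tetration_gap: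
  fixes p :: int
  assumes "a \<ge> 2" "prime p" "p dvd int a"
  shows "2 ^ b \<le> multiplicity p (int (tetration_gap a (Suc b)))"
proof -
  have "multiplicity p (int a) \<ge> 1"
    using assms by (intro multiplicity_geI) auto
  then have "tetration a b * 1 \<le> tetration a b * multiplicity p (int a)" by (intro mult_le_mono2)
  then show ?thesis
    using two_power_le_tetration[OF assms(1), of b] multiplicity_tetration_gap_Suc_dvd[OF assms, of b]
    by linarith
qed

section \<open>Constant speeds according to the common factors with 10\<close>

lemma congruence_speed_coprime_10:
  assumes "a \<ge> 2" "odd a" "\<not> 5 dvd a" "\<epsilon> \<in> {1, -1}" "4 dvd int a - \<epsilon>"
  shows "constant_congruence_speed a =
    Some (int (min (multiplicity 2 (int a - \<epsilon>)) (multiplicity 5 (int a ^ 4 - 1))))"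
proof -
  have "\<exists>N. \<forall>b\<ge>N. stable_digits a (Suc b) =
      stable_digits a b + min (multiplicity 2 (int a - \<epsilon>)) (multiplicity 5 (int a ^ 4 - 1))"
    unfolding stable_digits_eq[OF assms(1)]
    using multiplicity_2_tetration_gap_Suc[OF assms(1,2,4,5)] multiplicity_5_tetration_gap_Suc[OF assms(1,3)]
    by (intro min_linear_eventually_linear[of 2]) auto
  then show ?thesis using constant_congruence_speed_eqI[OF assms(1)] by blast
qed

text \<open>The 2-adic valuation grows at least exponentially, so the linearly growing 5-adic one is
  eventually the minimum.\<close>

lemma congruence_speed_even:
  assumes "a \<ge> 2" "even a" "\<not> 5 dvd a"
  shows "constant_congruence_speed a = Some (int (multiplicity 5 (int a ^ 4 - 1)))"
proof -
  let ?f = "\<lambda>b. multiplicity 5 (int (tetration_gap a b))"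
  let ?g = "\<lambda>b. multiplicity 2 (int (tetration_gap a b))"
  have f: "?f (Suc b) = ?f b + multiplicity 5 (int a ^ 4 - 1)" if "b \<ge> 2" for b
    using multiplicity_5_tetration_gap_Suc[OF assms(1,3) that] .
  then obtain N where N: "\<And>b. b \<ge> N \<Longrightarrow> ?f (Suc b) \<le> 2 ^ b"
    using linear_eventually_le_power[of 2 ?f] by blast
  have le: "?f (Suc b) \<le> ?g (Suc b)" if "b \<ge> N" for b
    using N[OF that] two_power_le_multiplicity_tetration_gap[of a 2 b] assms by simp
  \<comment> \<open>The minimum must be the 5-adic valuation at both \<open>b\<close> and
    \<open>Suc b\<close>, so \<open>le\<close> is needed at \<open>b\<close> and at its predecessor
    \<open>c\<close>.\<close>
  have "stable_digits a (Suc b) = stable_digits a b + multiplicity 5 (int a ^ 4 - 1)"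
    if b: "b \<ge> N + 2" for b
  proof -
    obtain c where "b = Suc c" using b by (cases b) auto
    then show ?thesis
      using f[of b] le[of b] le[of c] b by (simp add: stable_digits_eq[OF assms(1)])
  qed
  then show ?thesis by (rule constant_congruence_speed_eqI[OF assms(1)])
qed

text \<open>The primes exchange their roles: now the 5-adic valuation outgrows the 2-adic
  one.\<close>

lemma congruence_speed_odd_multiple_of_5:
  assumes "odd a" "5 dvd a" "\<epsilon> \<in> {1, -1}" "4 dvd int a - \<epsilon>"
  shows "constant_congruence_speed a = Some (int (multiplicity 2 (int a - \<epsilon>)))"
proof -
  have a: "a \<ge> 2" using assms(1,2) by presburger
  let ?f = "\<lambda>b. multiplicity 2 (int (tetration_gap a b))"
  let ?g = "\<lambda>b. multiplicity 5 (int (tetration_gap a b))"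
  have f: "?f (Suc b) = ?f b + multiplicity 2 (int a - \<epsilon>)" for b
    using multiplicity_2_tetration_gap_Suc[OF a assms(1,3,4)] .
  then obtain N where N: "\<And>b. b \<ge> N \<Longrightarrow> ?f (Suc b) \<le> 2 ^ b"
    using linear_eventually_le_power[of 0 ?f] by blast
  have "5 dvd int a" using assms(2) by presburger
  then have le: "?f (Suc b) \<le> ?g (Suc b)" if "b \<ge> N" for b
    using N[OF that] two_power_le_multiplicity_tetration_gap[OF a, of 5 b] by simp
  have "stable_digits a (Suc b) = stable_digits a b + multiplicity 2 (int a - \<epsilon>)"
    if b: "b \<ge> N + 1" for b
  proof -
    obtain c where "b = Suc c" using b by (cases b) auto
    then show ?thesis
      using f[of b] le[of b] le[of c] b by (simp add: stable_digits_eq[OF a])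
  qed
  then show ?thesis by (rule constant_congruence_speed_eqI[OF a])
qed

text \<open>From height 1 on the number of stable digits is \<open>m\<close> times the preceding
  tetration. The speeds are then \<open>m\<close> times the gaps, and these increase
  strictly.\<close>

lemma congruence_speed_multiple_of_10:
  assumes "10 dvd a" "a \<noteq> 0"
  shows "constant_congruence_speed a = None"
proof -
  have a: "a \<ge> 2" using assms by (auto elim!: dvdE)
  define m where "m = min (multiplicity 2 (int a)) (multiplicity 5 (int a))"
  have dvd: "2 dvd int a" "5 dvd int a" using assms(1) by presburger+
  then have "m \<ge> 1"
    unfolding m_def using a by (intro min.boundedI multiplicity_geI) auto
  have "stable_digits a (Suc b) = tetration a b * m" for b
    using dvd multiplicity_tetration_gap_Suc_dvd[OF a, of 2] multiplicity_tetration_gap_Suc_dvd[OF a, of 5]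
    by (simp add: stable_digits_eq[OF a] m_def nat_mult_min_right)
  then have speed: "congruence_speed a (Suc (Suc b)) = int (tetration_gap a b * m)" for b
    using tetration_less_Suc[OF a, of b]
    by (simp add: congruence_speed_def tetration_gap_def of_nat_diff algebra_simps del: tetration.simps)
  have False if ev: "\<forall>\<^sub>F b in sequentially. congruence_speed a b = v" for v
  proof -
    obtain N where N: "\<And>b. b \<ge> N \<Longrightarrow> congruence_speed a b = v"
      using ev unfolding eventually_sequentially by blast
    have "int (tetration_gap a N * m) = int (tetration_gap a (Suc N) * m)"
      using N[of "Suc (Suc N)"] N[of "Suc (Suc (Suc N))"] speed by simp
    then show False using tetration_gap_strict_mono[OF a, of N] \<open>m \<ge> 1\<close> by simp
  qed
  then show ?thesis using a by (auto simp: constant_congruence_speed_def)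
qed

section \<open>Decadic solutions of \<open>y ^ 5 = y\<close>\<close>

lemma residue_nonneg [simp]: "0 \<le> residue y n"
  and residue_less [simp]: "residue y n < 10 ^ n"
  using residue[of y] by auto

lemma residue_mod_power:
  assumes "m \<le> n"
  shows "residue y n mod 10 ^ m = residue y m"
  using assms
proof (induction n rule: dec_induct)
  case (step n)
  have "residue y (Suc n) mod 10 ^ m = residue y (Suc n) mod 10 ^ n mod 10 ^ m"
    using step.hyps(1) by (simp add: mod_mod_cancel le_imp_power_dvd)
  then show ?case using residue[of y] step.IH by auto
qed simp

lemma residue_of_nat: "residue (of_nat a) n = int a mod 10 ^ n"
proof (induction a)
  case (Suc a)
  then show ?case
    by (simp add: plus_decadic.rep_eq one_decadic.rep_eq mod_simps add.commute)
qed (simp add: zero_decadic.rep_eq)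

lemma residue_power: "residue (y ^ k) n = residue y n ^ k mod 10 ^ n"
  by (induction k) (simp_all add: times_decadic.rep_eq one_decadic.rep_eq mod_simps)

lemma decadic_eqI: "(\<And>n. residue x n = residue y n) \<Longrightarrow> x = y"
  by (metis ext residue_inject)

text \<open>The quotient arises by dropping the last \<open>k\<close> digits: its residue at level
  \<open>n\<close> is the residue of \<open>y\<close> at level \<open>k + n\<close>, divided by
  \<open>10 ^ k\<close>.\<close>

lemma power_10_dvd_decadic_iff: "10 ^ k dvd y \<longleftrightarrow> residue y k = 0"
proof
  have "residue (10 ^ k) k = 0"
    using residue_of_nat[of "10 ^ k" k] by simp
  moreover assume "10 ^ k dvd y"
  then obtain w where "y = 10 ^ k * w" by (elim dvdE)
  ultimately show "residue y k = 0" by (simp add: times_decadic.rep_eq)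
next
  assume y: "residue y k = 0"
  define r where "r n = residue y (k + n)" for n
  have r_dvd: "10 ^ k * (r n div 10 ^ k) = r n" for n
    using residue_mod_power[of k "k + n" y] y by (simp add: r_def mod_eq_0_iff_dvd)
  have r_mod: "r (Suc n) mod (10 ^ k * 10 ^ n) = r n" for n
    using residue_mod_power[of "k + n" "k + Suc n" y] by (simp add: r_def power_add)
  have "r n div 10 ^ k \<in> {0..<10 ^ n} \<and> (r (Suc n) div 10 ^ k) mod 10 ^ n = r n div 10 ^ k" for n
  proof -
    have "10 ^ k * (r n div 10 ^ k) < 10 ^ k * 10 ^ n"
      unfolding r_dvd using residue_less[of y "k + n"] by (simp add: r_def power_add)
    moreover have "r n div 10 ^ k = (r (Suc n) div 10 ^ k) mod 10 ^ n"
      unfolding r_mod[of n, symmetric] by (simp add: zmod_zmult2_eq)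
    ultimately show ?thesis by (simp add: r_def pos_imp_zdiv_nonneg_iff)
  qed
  then have w: "residue (Abs_decadic (\<lambda>n. r n div 10 ^ k)) n = r n div 10 ^ k" for n
    by (subst Abs_decadic_inverse) auto
  have "y = 10 ^ k * Abs_decadic (\<lambda>n. r n div 10 ^ k)"
  proof (rule decadic_eqI)
    fix n
    have "residue (10 ^ k) n = 10 ^ k mod 10 ^ n"
      using residue_of_nat[of "10 ^ k" n] by simp
    then have "residue (10 ^ k * Abs_decadic (\<lambda>n. r n div 10 ^ k)) n = r n mod 10 ^ n"
      by (simp add: times_decadic.rep_eq w mod_simps r_dvd)
    then show "residue y n = residue (10 ^ k * Abs_decadic (\<lambda>n. r n div 10 ^ k)) n"
      using residue_mod_power[of n "k + n" y] by (simp add: r_def)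
  qed
  then show "10 ^ k dvd y" by (rule dvdI)
qed

lemma power_10_dvd_of_nat_minus_iff:
  "10 ^ k dvd of_nat a - y \<longleftrightarrow> 10 ^ k dvd int a - residue y k"
  unfolding power_10_dvd_decadic_iff
  by (simp add: minus_decadic.rep_eq residue_of_nat mod_simps mod_eq_0_iff_dvd)

section \<open>Solutions prime to 10: a sign and a fourth root of unity\<close>

text \<open>The residues are prime to 10, so one factor cancels from \<open>y ^ 5 = y\<close> and
  leaves \<open>y ^ 4 = 1\<close>. In the 2-adic integers the class modulo 4 singles out the root
  \<open>\<epsilon>\<close>.\<close>

lemma fifth_root_residue:
  fixes y :: decadic
  assumes y: "y ^ 5 = y" and "\<epsilon> \<in> {1, -1}" "4 dvd residue y 2 - \<epsilon>" "\<not> 5 dvd residue y 2"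
  shows "2 ^ k dvd residue y k - \<epsilon>" and "5 ^ k dvd residue y k ^ 4 - 1"
proof -
  \<comment> \<open>Two extra digits make up for the factor 4 that \<open>R ^ 4 - 1\<close> contains
    beside \<open>R - \<epsilon>\<close>.\<close>
  define R where "R = residue y (k + 2)"
  have R: "R mod 100 = residue y 2" "R mod 10 ^ k = residue y k"
    using residue_mod_power[of 2 "k + 2" y] residue_mod_power[of k "k + 2" y] by (simp_all add: R_def)
  obtain c where c: "R = \<epsilon> + 4 * c"
  proof -
    have "4 dvd R - residue y 2" unfolding R(1)[symmetric] by presburger
    then have "4 dvd R - \<epsilon>" using dvd_add[OF _ assms(3), of "R - residue y 2"] by simp
    then obtain c where "R - \<epsilon> = 4 * c" by (elim dvdE)
    then show thesis using that[of c] by simp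
  qed
  have not5: "\<not> 5 dvd R" using assms(4) unfolding R(1)[symmetric] by presburger
  have oddR: "odd R" using c assms(2) by auto
  have "R ^ 5 mod 10 ^ (k + 2) = R mod 10 ^ (k + 2)"
    using residue_power[of y 5 "k + 2"] unfolding y R_def residue_mod by (rule sym)
  then have "10 ^ (k + 2) dvd R * (R ^ 4 - 1)"
    by (simp add: mod_eq_dvd_iff algebra_simps eval_nat_numeral)
  then have dvd: "2 ^ (k + 2) dvd R * (R ^ 4 - 1)" "5 ^ (k + 2) dvd R * (R ^ 4 - 1)"
    unfolding power_10_dvd_iff by auto
  have "10 ^ k dvd R - residue y k"
    unfolding R(2)[symmetric] by (simp add: minus_mod_eq_mult_div)
  then have Ry: "[R = residue y k] (mod 2 ^ k)" "[R = residue y k] (mod 5 ^ k)"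
    unfolding power_10_dvd_iff cong_iff_dvd_diff by auto
  have "2 ^ k dvd R - \<epsilon>"
  proof -
    have "coprime (2 ^ (k + 2)) R" using oddR by (simp only: coprime_power_left_iff coprime_left_2_iff_odd simp_thms)
    then have "2 ^ (k + 2) dvd R ^ 4 - 1" using dvd(1) by (metis coprime_dvd_mult_right_iff)
    \<comment> \<open>This is \<open>(R - \<epsilon>) * (R + \<epsilon>) * (R ^ 2 + 1)\<close> with
      \<open>R = \<epsilon> + 4 * c\<close> inserted; the last two factors are each twice an odd
      number.\<close>
    moreover have "R ^ 4 - 1 = 4 * ((R - \<epsilon>) * ((\<epsilon> + 2 * c) * (1 + 4 * c * \<epsilon> + 8 * c\<^sup>2)))"
      using assms(2) by (auto simp: c algebra_simps eval_nat_numeral)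
    ultimately have "2 ^ k dvd (R - \<epsilon>) * ((\<epsilon> + 2 * c) * (1 + 4 * c * \<epsilon> + 8 * c\<^sup>2))"
      by (simp add: power_add)
    moreover have "coprime (2 ^ k) ((\<epsilon> + 2 * c) * (1 + 4 * c * \<epsilon> + 8 * c\<^sup>2))"
      using assms(2) by (auto simp: coprime_left_2_iff_odd)
    ultimately show ?thesis by (metis coprime_dvd_mult_left_iff)
  qed
  with Ry(1) show "2 ^ k dvd residue y k - \<epsilon>"
    unfolding cong_iff_dvd_diff[symmetric] by (meson cong_sym cong_trans)
  have "coprime ((5::int) ^ (k + 2)) R"
    using prime_imp_coprime[of 5 R] not5 by (simp only: coprime_power_left_iff) simp
  then have "5 ^ (k + 2) dvd R ^ 4 - 1" using dvd(2) by (metis coprime_dvd_mult_right_iff)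
  then have "[R ^ 4 = 1] (mod 5 ^ k)"
    unfolding cong_iff_dvd_diff by (rule power_le_dvd) simp
  with Ry(2) show "5 ^ k dvd residue y k ^ 4 - 1"
    unfolding cong_iff_dvd_diff[symmetric] by (meson cong_pow cong_sym cong_trans)
qed

text \<open>The cofactor of \<open>x - y\<close> is congruent to \<open>4 * x ^ 3\<close> modulo 5,
  hence prime to 5.\<close>

lemma fourth_power_diff_dvd_iff:
  fixes x y :: int
  assumes "[x = y] (mod 5)" "\<not> 5 dvd x"
  shows "5 ^ k dvd x - y \<longleftrightarrow> 5 ^ k dvd x ^ 4 - y ^ 4"
proof -
  let ?q = "x ^ 3 + x\<^sup>2 * y + x * y\<^sup>2 + y ^ 3"
  have "[?q = x ^ 3 + x\<^sup>2 * x + x * x\<^sup>2 + x ^ 3] (mod 5)"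
    using assms(1) by (intro cong_add cong_mult cong_pow) (auto simp: cong_sym)
  moreover have "x ^ 3 + x\<^sup>2 * x + x * x\<^sup>2 + x ^ 3 = 4 * x ^ 3" by (simp add: eval_nat_numeral)
  moreover have "\<not> 5 dvd 4 * x ^ 3"
    using assms(2) prime_dvd_mult_iff[of 5 4 "x ^ 3"] prime_dvd_power[of 5 x 3] by auto
  ultimately have "\<not> 5 dvd ?q" by (metis cong_dvd_iff)
  then have "coprime (5 ^ k) ?q" by (simp add: prime_imp_coprime)
  moreover have "x ^ 4 - y ^ 4 = (x - y) * ?q" by (simp add: algebra_simps eval_nat_numeral)
  ultimately show ?thesis by (simp add: coprime_dvd_mult_left_iff)
qed

text \<open>Modulo \<open>2 ^ k\<close> the root is \<open>\<epsilon>\<close>. Modulo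
  \<open>5 ^ k\<close> its fourth power is 1, and since \<open>a\<close> agrees with it modulo 5,
  fourth powers may be compared instead.\<close>

lemma fifth_root_dvd_iffs:
  fixes y :: decadic and a :: int
  assumes "y ^ 5 = y" and a: "[a = residue y 2] (mod 20)"
    and "\<epsilon> \<in> {1, -1}" "4 dvd a - \<epsilon>" "\<not> 5 dvd a"
  shows "(2 ^ k dvd a - residue y k \<longleftrightarrow> 2 ^ k dvd a - \<epsilon>) \<and>
    (5 ^ k dvd a - residue y k \<longleftrightarrow> 5 ^ k dvd a ^ 4 - 1)"
proof (cases "k = 0")
  \<comment> \<open>From \<open>k = 1\<close> on the residue knows the last digit, and so the class
    modulo 5; for \<open>k = 0\<close> both divisibilities are trivial.\<close>
  case False
  have y4: "4 dvd residue y 2 - \<epsilon>" and y5: "\<not> 5 dvd residue y 2"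
  proof -
    have a4: "[residue y 2 = a] (mod 4)" "[residue y 2 = a] (mod 5)"
      using cong_dvd_modulus[OF cong_sym[OF a], of 4] cong_dvd_modulus[OF cong_sym[OF a], of 5] by simp_all
    show "4 dvd residue y 2 - \<epsilon>"
      using a4(1) assms(4) by (metis cong_iff_dvd_diff cong_trans)
    show "\<not> 5 dvd residue y 2" using a4(2) assms(5) by (simp add: cong_dvd_iff)
  qed
  note root = fifth_root_residue[OF assms(1,3) y4 y5, of k]
  have "[residue y 2 = residue y k] (mod 5)"
  proof -
    have "residue y 2 mod 10 = residue y 1" "residue y k mod 10 = residue y 1"
      using residue_mod_power[of 1 2 y] residue_mod_power[of 1 k y] False by simp_all
    then have "[residue y 2 = residue y k] (mod 10)" by (simp add: cong_def)
    then show ?thesis by (rule cong_dvd_modulus) simp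
  qed
  moreover have "[a = residue y 2] (mod 5)" by (rule cong_dvd_modulus[OF a]) simp
  ultimately have "[a = residue y k] (mod 5)" by (rule cong_trans[rotated])
  then have "5 ^ k dvd a - residue y k \<longleftrightarrow> [a ^ 4 = residue y k ^ 4] (mod 5 ^ k)"
    using fourth_power_diff_dvd_iff assms(5) by (simp add: cong_iff_dvd_diff)
  also have "\<dots> \<longleftrightarrow> [a ^ 4 = 1] (mod 5 ^ k)"
    using root(2) unfolding cong_iff_dvd_diff[symmetric] by (meson cong_sym cong_trans)
  finally have "5 ^ k dvd a - residue y k \<longleftrightarrow> 5 ^ k dvd a ^ 4 - 1" by (simp add: cong_iff_dvd_diff)
  moreover have "2 ^ k dvd a - residue y k \<longleftrightarrow> 2 ^ k dvd a - \<epsilon>"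
    using root(1) unfolding cong_iff_dvd_diff[symmetric] by (meson cong_sym cong_trans)
  ultimately show ?thesis by blast
qed simp

lemma odd_int_cong_unit_mod_4:
  fixes x :: int
  assumes "odd x"
  obtains \<epsilon> where "\<epsilon> \<in> {1, -1}" "4 dvd x - \<epsilon>"
proof -
  have "4 dvd x - 1 \<or> 4 dvd x - (-1)" using assms by presburger
  then show thesis using that by blast
qed

text \<open>The last two digits fix the sign and the class modulo 5, and these determine the root
  modulo every power of 10.\<close>

lemma fifth_root_eqI:
  fixes y z :: decadic
  assumes "y ^ 5 = y" "z ^ 5 = z" "residue y 2 = residue z 2"
    and "odd (residue z 2)" "\<not> 5 dvd residue z 2"
  shows "y = z"
proof -
  obtain \<epsilon> where eps: "\<epsilon> \<in> {1, -1}" "4 dvd residue z 2 - \<epsilon>"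
    using odd_int_cong_unit_mod_4 assms(4) by blast
  have ge2: "residue y n = residue z n" if "n \<ge> 2" for n
  proof -
    have z100: "[residue z n = residue z 2] (mod 100)"
      using residue_mod_power[OF that, of z] residue_mod[of z 2] by (simp add: cong_def)
    have "[residue z n = residue y 2] (mod 20)"
      unfolding assms(3) by (rule cong_dvd_modulus[OF z100]) simp
    moreover have "4 dvd residue z n - \<epsilon>"
      using cong_dvd_modulus[OF z100, of 4] eps(2)
      unfolding cong_iff_dvd_diff[symmetric] by (auto intro: cong_trans)
    moreover have "\<not> 5 dvd residue z n"
      using cong_dvd_modulus[OF z100, of 5] assms(5) by (simp add: cong_dvd_iff)
    \<comment> \<open>The residue of \<open>z\<close> takes the part of the integer that is compared
      with the root \<open>y\<close>.\<close>
    ultimately have "10 ^ n dvd residue z n - residue y n"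
      unfolding power_10_dvd_iff
      using fifth_root_dvd_iffs[OF assms(1) _ eps(1), of "residue z n" n]
        fifth_root_residue[OF assms(2) eps(1,2) assms(5), of n] by blast
    then have "residue z n mod 10 ^ n = residue y n mod 10 ^ n" by (simp only: mod_eq_dvd_iff)
    then show ?thesis by simp
  qed
  show ?thesis
  proof (rule decadic_eqI)
    fix n
    have "residue y n = residue y (n + 2) mod 10 ^ n" "residue z n = residue z (n + 2) mod 10 ^ n"
      using residue_mod_power[of n "n + 2"] by simp_all
    then show "residue y n = residue z n" using ge2[of "n + 2"] by simp
  qed
qed

section \<open>Existence of solutions by iterated fifth powers\<close>

text \<open>The cofactor of \<open>u - v\<close> is congruent to \<open>5 * v ^ 4\<close> modulo 5
  and so contributes one more factor 5.\<close>

lemma fifth_power_cong_lift: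
  fixes u v :: int
  assumes "5 ^ Suc n dvd u - v"
  shows "5 ^ Suc (Suc n) dvd u ^ 5 - v ^ 5"
proof -
  have "[u = v] (mod 5)"
    using assms by (simp add: cong_iff_dvd_diff dvd_mult_left)
  then have "[u ^ 4 + u ^ 3 * v + u\<^sup>2 * v\<^sup>2 + u * v ^ 3 + v ^ 4
      = v ^ 4 + v ^ 3 * v + v\<^sup>2 * v\<^sup>2 + v * v ^ 3 + v ^ 4] (mod 5)"
    by (intro cong_add cong_mult cong_pow) auto
  moreover have "v ^ 4 + v ^ 3 * v + v\<^sup>2 * v\<^sup>2 + v * v ^ 3 + v ^ 4 = 5 * v ^ 4"
    by (simp add: eval_nat_numeral)
  ultimately have "5 dvd u ^ 4 + u ^ 3 * v + u\<^sup>2 * v\<^sup>2 + u * v ^ 3 + v ^ 4"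
    by (metis cong_dvd_iff dvd_triv_left)
  then have "5 ^ Suc n * 5 dvd (u - v) * (u ^ 4 + u ^ 3 * v + u\<^sup>2 * v\<^sup>2 + u * v ^ 3 + v ^ 4)"
    using assms by (intro mult_dvd_mono)
  then show ?thesis by (simp add: algebra_simps eval_nat_numeral)
qed

lemma iterated_fifth_power_cong:
  fixes u v :: int
  assumes "5 dvd u - v"
  shows "5 ^ Suc n dvd u ^ 5 ^ n - v ^ 5 ^ n"
proof (induction n)
  case (Suc n)
  have "u ^ 5 ^ Suc n - v ^ 5 ^ Suc n = (u ^ 5 ^ n) ^ 5 - (v ^ 5 ^ n) ^ 5"
    by (simp add: mult.commute flip: power_mult)
  then show ?case using fifth_power_cong_lift[OF Suc.IH] by metis
qed (use assms in simp)

text \<open>Fermat's congruence between \<open>x ^ 5\<close> and \<open>x\<close> is raised to the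
  power \<open>5 ^ n\<close>. It makes the sequence \<open>x ^ 5 ^ n\<close> converge in the 5-adic
  integers.\<close>

lemma iterated_fifth_power_fermat:
  fixes x :: int
  shows "5 ^ n dvd x ^ 5 ^ Suc n - x ^ 5 ^ n"
proof -
  have "5 dvd x ^ 5 - x"
  proof (cases "5 dvd x")
    case False
    then have "5 dvd x * (x ^ 4 - 1)" using five_dvd_fourth_power_minus_one by (intro dvd_mult)
    then show ?thesis by (simp add: algebra_simps eval_nat_numeral)
  next
    case True
    moreover from this have "5 dvd x ^ 5" by (rule dvd_trans) simp
    ultimately show ?thesis by (intro dvd_diff)
  qed
  then have "5 ^ Suc n dvd (x ^ 5) ^ 5 ^ n - x ^ 5 ^ n" by (rule iterated_fifth_power_cong)
  then have "5 ^ Suc n dvd x ^ 5 ^ Suc n - x ^ 5 ^ n" by (simp flip: power_mult)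
  then show ?thesis by (rule power_le_dvd) simp
qed

lemma power_2_dvd_even_power:
  fixes x :: int
  assumes "even x"
  shows "2 ^ n dvd x ^ 5 ^ n"
proof -
  have "n \<le> 5 ^ n" using less_power_self[of 5 n] by simp
  then have "(2::int) ^ n dvd 2 ^ 5 ^ n" by (rule le_imp_power_dvd)
  also have "\<dots> dvd x ^ 5 ^ n" using assms by (rule dvd_power_same)
  finally show ?thesis .
qed

lemma fifth_root_exists:
  fixes r :: int
  assumes "odd r" and r4: "25 dvd r ^ 4 - 1"
  obtains y where "y ^ 5 = y" "residue y 2 = r mod 100"
proof -
  obtain \<epsilon> where eps: "\<epsilon> \<in> {1, -1}" "4 dvd r - \<epsilon>"
    using odd_int_cong_unit_mod_4 assms(1) by blast
  \<comment> \<open>The powers \<open>6 ^ 5 ^ n\<close> tend to 0 in the 2-adic and to 1 in the 5-adic integers, so this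
    sequence tends to \<open>\<epsilon>\<close> and to the Teichmueller representative of \<open>r\<close> respectively.\<close>
  define f where "f n = (6 * r) ^ 5 ^ n + \<epsilon> * (1 - 6 ^ 5 ^ n)" for n :: nat
  have f2: "[f n = \<epsilon>] (mod 2 ^ n)" for n
  proof -
    have "2 ^ n dvd (6 * r) ^ 5 ^ n - \<epsilon> * 6 ^ 5 ^ n"
      by (rule dvd_diff[OF power_2_dvd_even_power dvd_mult[OF power_2_dvd_even_power]]) simp_all
    then show ?thesis by (simp add: f_def cong_iff_dvd_diff algebra_simps)
  qed
  have f5: "[f n = r ^ 5 ^ n] (mod 5 ^ n)" for n
  proof -
    have "5 ^ Suc n dvd (6::int) ^ 5 ^ n - 1"
      using iterated_fifth_power_cong[of 6 1 n] by simp
    then have "5 ^ n dvd (6::int) ^ 5 ^ n - 1" by (rule power_le_dvd) simp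
    then have "5 ^ n dvd (6 ^ 5 ^ n - 1) * (r ^ 5 ^ n - \<epsilon>)" by (rule dvd_mult2)
    then show ?thesis by (simp add: f_def cong_iff_dvd_diff power_mult_distrib algebra_simps)
  qed
  have fermat: "[r ^ 5 ^ Suc n = r ^ 5 ^ n] (mod 5 ^ n)" for n
    unfolding cong_iff_dvd_diff by (rule iterated_fifth_power_fermat)
  have "f (Suc n) mod 10 ^ n = f n mod 10 ^ n" for n
  proof -
    have "[f (Suc n) = \<epsilon>] (mod 2 ^ n)" by (rule cong_dvd_modulus[OF f2]) simp
    then have "[f (Suc n) = f n] (mod 2 ^ n)" using f2 by (metis cong_sym cong_trans)
    moreover have "[f (Suc n) = r ^ 5 ^ Suc n] (mod 5 ^ n)" by (rule cong_dvd_modulus[OF f5]) simp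
    then have "[f (Suc n) = f n] (mod 5 ^ n)" using f5 fermat by (meson cong_sym cong_trans)
    ultimately show ?thesis unfolding mod_eq_dvd_iff power_10_dvd_iff cong_iff_dvd_diff by blast
  qed
  then have res: "residue (Abs_decadic (\<lambda>n. f n mod 10 ^ n)) n = f n mod 10 ^ n" for n
    using coherent_mod[of f] by (subst Abs_decadic_inverse) auto
  show thesis
  proof (rule that)
    show "Abs_decadic (\<lambda>n. f n mod 10 ^ n) ^ 5 = Abs_decadic (\<lambda>n. f n mod 10 ^ n)"
    proof (rule decadic_eqI)
      fix n
      have "[f n ^ 5 = \<epsilon> ^ 5] (mod 2 ^ n)" using f2 by (rule cong_pow)
      moreover have "\<epsilon> ^ 5 = \<epsilon>" using eps(1) by auto
      ultimately have "[f n ^ 5 = f n] (mod 2 ^ n)" using f2 by (metis cong_sym cong_trans)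
      moreover have "[f n ^ 5 = (r ^ 5 ^ n) ^ 5] (mod 5 ^ n)" using f5 by (rule cong_pow)
      then have "[f n ^ 5 = r ^ 5 ^ Suc n] (mod 5 ^ n)" by (simp add: mult.commute flip: power_mult)
      then have "[f n ^ 5 = f n] (mod 5 ^ n)" using f5 fermat by (meson cong_sym cong_trans)
      ultimately have "f n ^ 5 mod 10 ^ n = f n mod 10 ^ n"
        unfolding mod_eq_dvd_iff power_10_dvd_iff cong_iff_dvd_diff by blast
      then show "residue (Abs_decadic (\<lambda>n. f n mod 10 ^ n) ^ 5) n = residue (Abs_decadic (\<lambda>n. f n mod 10 ^ n)) n"
        by (simp add: residue_power res mod_simps)
    qed
    \<comment> \<open>Modulo 25, \<open>f 2\<close> is \<open>r ^ 25\<close>; since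
      \<open>r ^ 24\<close> is 1 there, the limit keeps the last two digits of
      \<open>r\<close>.\<close>
    have "[r ^ 4 = 1] (mod 25)" using r4 by (simp add: cong_iff_dvd_diff)
    then have "[(r ^ 4) ^ 6 * r = 1 ^ 6 * r] (mod 25)" by (intro cong_mult cong_pow) auto
    then have "[r ^ 25 = r] (mod 25)" by (simp flip: power_mult power_Suc2)
    then have "[f 2 = r] (mod 5 ^ 2)" using f5[of 2] by (simp add: cong_trans)
    moreover have "[f 2 = r] (mod 2 ^ 2)"
      using f2[of 2] eps(2) by (simp add: cong_iff_dvd_diff[symmetric]) (meson cong_sym cong_trans)
    ultimately have "f 2 mod 10 ^ 2 = r mod 10 ^ 2"
      unfolding mod_eq_dvd_iff power_10_dvd_iff cong_iff_dvd_diff by blast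
    then show "residue (Abs_decadic (\<lambda>n. f n mod 10 ^ n)) 2 = r mod 100" by (simp add: res)
  qed
qed

section \<open>Solutions identified by their last two digits\<close>

lemma decadic_digit_1_2:
  "decadic_digit y 1 = residue y 2 mod 10" "decadic_digit y 2 = residue y 2 div 10"
  using residue_mod_power[of 1 2 y] by (simp_all add: decadic_digit_def)

lemma fifth_root_eq_alpha:
  assumes "x1 \<in> {0..9}" "x2 \<in> {0..9}" "odd x1" "x1 \<noteq> 5"
    and "y ^ 5 = y" "residue y 2 = 10 * x2 + x1"
  shows "y = alpha x2 x1"
  unfolding alpha_def
proof (rule the_equality[symmetric])
  show "y ^ 5 = y \<and> decadic_digit y 2 = x2 \<and> decadic_digit y 1 = x1"
    using assms by (simp add: decadic_digit_1_2[simplified])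
  fix z assume z: "z ^ 5 = z \<and> decadic_digit z 2 = x2 \<and> decadic_digit z 1 = x1"
  then have "residue z 2 = residue y 2"
    unfolding assms(6) using div_mult_mod_eq[of "residue z 2" 10] by (simp add: decadic_digit_1_2[simplified])
  moreover have "odd (residue y 2)" unfolding assms(6) using assms(3) by simp
  moreover have "\<not> 5 dvd residue y 2"
    unfolding assms(6)
  proof
    assume "5 dvd 10 * x2 + x1"
    then have "5 dvd x1" by (simp add: dvd_add_right_iff)
    then show False using assms(1,3,4) by (auto elim!: dvdE) presburger
  qed
  ultimately show "z = y" using z assms(5) fifth_root_eqI by blast
qed

lemma alpha_fifth_root:
  assumes "x1 \<in> {0..9}" "x2 \<in> {0..9}" "odd x1" "x1 \<noteq> 5" "25 dvd (10 * x2 + x1) ^ 4 - 1"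
  shows "alpha x2 x1 ^ 5 = alpha x2 x1" "residue (alpha x2 x1) 2 = 10 * x2 + x1"
proof -
  have "odd (10 * x2 + x1)" using assms(3) by simp
  then obtain y where y: "y ^ 5 = y" "residue y 2 = (10 * x2 + x1) mod 100"
    using fifth_root_exists assms(5) by blast
  then have "residue y 2 = 10 * x2 + x1" using assms(1,2) by simp
  then show "alpha x2 x1 ^ 5 = alpha x2 x1" "residue (alpha x2 x1) 2 = 10 * x2 + x1"
    using fifth_root_eq_alpha[OF assms(1-4) y(1)] y(1) by auto
qed

lemma alpha_01: "alpha 0 1 = 1"
  by (rule fifth_root_eq_alpha[symmetric]) (simp_all add: one_decadic.rep_eq)

lemma alpha_99: "alpha 9 9 = -1"
  by (rule fifth_root_eq_alpha[symmetric]) (simp_all add: uminus_decadic.rep_eq one_decadic.rep_eq)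

lemma decadic_digit_one:
  assumes "l \<ge> 2"
  shows "decadic_digit 1 l = 0"
proof -
  have "(1::int) < 10 ^ (l - 1)" "(1::int) < 10 ^ l" using assms by (auto intro: one_less_power)
  then show ?thesis by (simp add: decadic_digit_def one_decadic.rep_eq)
qed

lemma decadic_digit_minus_one:
  assumes "l \<ge> 1"
  shows "decadic_digit (-1) l = 9"
proof -
  define P :: int where "P = 10 ^ (l - 1)"
  have P: "P > 0" "10 ^ l = 10 * P" using assms by (simp_all add: P_def flip: power_Suc)
  have "residue (-1) l = (-1) mod (10 * P)"
    by (simp add: uminus_decadic.rep_eq one_decadic.rep_eq P(2) mod_simps)
  also have "\<dots> = 10 * P - 1" using P(1) by (simp add: zmod_minus1)
  \<comment> \<open>The residue \<open>10 ^ l - 1\<close> is split into its leading digit 9 and a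
    remainder below \<open>P\<close>.\<close>
  finally have "residue (-1) l = (P - 1) + 9 * P" by simp
  moreover have "((P - 1) + 9 * P) div P = 9 + (P - 1) div P"
    using P(1) by (intro div_mult_self1) simp
  moreover have "(P - 1) div P = 0" using P(1) by (intro div_pos_pos_trivial) simp_all
  ultimately show ?thesis unfolding decadic_digit_def P_def[symmetric] by simp
qed

section \<open>Key digits\<close>

lemma is_key_position_unique:
  assumes "is_key_position a x l" "is_key_position a x l'"
  shows "l = l'"
proof -
  have "\<not> l < l'" if "is_key_position a x l" "is_key_position a x l'" for l l'
  proof
    assume "l < l'"
    then have "(10 :: decadic) ^ l dvd 10 ^ (l' - 1)" by (intro le_imp_power_dvd) simp
    then show False using that unfolding is_key_position_def by (meson dvd_trans)
  qed
  then show ?thesis using assms by (meson linorder_neqE_nat)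
qed

lemma key_position_eqI: "is_key_position a x l \<Longrightarrow> key_position a x = l"
  unfolding key_position_def using is_key_position_unique by blast

lemma key_digit_eqI:
  assumes "is_key_position a x l"
  shows "key_digit a x = decimal_digit a l"
  using assms key_position_eqI[OF assms] by (auto simp: key_digit_def)

lemma decimal_digit_eq_0:
  assumes "a < 10" "l \<ge> 2"
  shows "decimal_digit a l = 0"
proof -
  have "(10::nat) ^ 1 \<le> 10 ^ (l - 1)" using assms(2) by (intro power_increasing) auto
  then show ?thesis using assms(1) by (simp add: decimal_digit_def)
qed

lemma decimal_digit_bounds: "0 \<le> decimal_digit a m" "decimal_digit a m \<le> 9"
proof -
  have "a div 10 ^ (m - 1) mod 10 < 10" by simp
  then show "0 \<le> decimal_digit a m" "decimal_digit a m \<le> 9"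
    unfolding decimal_digit_def by linarith+
qed

lemma key_digit_bounds: "0 \<le> key_digit a x" "key_digit a x \<le> 9"
  by (simp_all add: key_digit_def decimal_digit_bounds)

text \<open>Key positions start at 2, beyond the only digit of \<open>a\<close>; without a key
  position the default 0 applies.\<close>

lemma key_digit_eq_0:
  assumes "a < 10"
  shows "key_digit a x = 0"
proof (cases "\<exists>l. is_key_position a x l")
  case True
  then obtain l where l: "is_key_position a x l" by blast
  then have "l \<ge> 2" by (simp add: is_key_position_def)
  then show ?thesis using key_digit_eqI[OF l] decimal_digit_eq_0[OF assms] by simp
qed (simp add: key_digit_def)

text \<open>A digit, scaled by its place value, is what the residue gains from one level to the
  next.\<close>

lemma decimal_digit_minus_decadic_digit:
  "10 ^ m * (decimal_digit a (Suc m) - decadic_digit y (Suc m)) =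
    (int a mod 10 ^ Suc m - int a mod 10 ^ m) - (residue y (Suc m) - residue y m)"
proof -
  have "int a mod (10 ^ m * 10) = 10 ^ m * (int a div 10 ^ m mod 10) + int a mod 10 ^ m"
    by (rule zmod_zmult2_eq) simp
  then have "10 ^ m * decimal_digit a (Suc m) = int a mod 10 ^ Suc m - int a mod 10 ^ m"
    by (simp add: decimal_digit_def zdiv_int zmod_int mult.commute)
  moreover have "10 ^ m * decadic_digit y (Suc m) = residue y (Suc m) - residue y m"
    using mult_div_mod_eq[of "10 ^ m" "residue y (Suc m)"] residue_mod_power[of m "Suc m" y]
    by (simp add: decadic_digit_def)
  ultimately show ?thesis by (simp add: right_diff_distrib)
qed

text \<open>With \<open>m = min u w\<close>, the difference of \<open>a\<close> and \<open>y\<close>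
  modulo \<open>10 ^ Suc m\<close> is \<open>10 ^ m\<close> times the difference of the digits at
  \<open>Suc m\<close>. So 5 divides the latter if and only if \<open>5 ^ Suc m\<close> divides the
  former, that is \<open>m < w\<close>, that is \<open>u < w\<close>.\<close>

lemma key_position_and_digit:
  fixes a :: nat and y :: decadic
  assumes a: "a \<ge> 2" and y: "y ^ 5 = y" "[int a = residue y 2] (mod 20)"
    and eps: "\<epsilon> \<in> {1, -1}" "4 dvd int a - \<epsilon>" and not5: "\<not> 5 dvd a"
  defines "u \<equiv> multiplicity 2 (int a - \<epsilon>)" and "w \<equiv> multiplicity 5 (int a ^ 4 - 1)"
  shows "key_position a y = Suc (min u w)" (is ?pos)
    and "\<bar>key_digit a y - decadic_digit y (key_position a y)\<bar> = 5 \<longleftrightarrow> u < w" (is ?digit)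
    and "key_position a y \<ge> 2" (is ?ge)
proof -
  have not5': "\<not> 5 dvd int a" using not5 by presburger
  note dvds = fifth_root_dvd_iffs[OF y eps not5']
  have ne2: "int a - \<epsilon> \<noteq> 0" using a eps(1) by auto
  have ne5: "int a ^ 4 - 1 \<noteq> 0" using a one_less_power[of "int a" 4] by linarith
  have dvd2: "2 ^ k dvd int a - residue y k \<longleftrightarrow> k \<le> u" for k
    using dvds ne2 by (simp add: u_def power_dvd_iff_le_multiplicity)
  have dvd5: "5 ^ k dvd int a - residue y k \<longleftrightarrow> k \<le> w" for k
    using dvds ne5 by (simp add: w_def power_dvd_iff_le_multiplicity)
  \<comment> \<open>These bounds give \<open>min u w \<ge> 1\<close>, so the key position is at
    least 2.\<close>
  have "2 ^ 2 dvd int a - \<epsilon>" using eps(2) by simp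
  then have u: "u \<ge> 2" unfolding u_def using ne2 by (intro multiplicity_geI) auto
  have "5 ^ 1 dvd int a ^ 4 - 1" using five_dvd_fourth_power_minus_one[OF not5'] by simp
  then have w: "w \<ge> 1" unfolding w_def using ne5 by (intro multiplicity_geI) auto
  define m where "m = min u w"
  have dvd: "10 ^ k dvd of_nat a - y \<longleftrightarrow> k \<le> m" for k
    by (simp add: power_10_dvd_of_nat_minus_iff power_10_dvd_iff dvd2 dvd5 m_def)
  have key: "is_key_position a y (Suc m)"
    unfolding is_key_position_def dvd using u w by (simp add: m_def)
  show ?pos using key_position_eqI[OF key] by (simp add: m_def)
  then show ?ge using u w by simp
  define s where "s = decimal_digit a (Suc m)"
  define d where "d = decadic_digit y (Suc m)"
  have "[int a = residue y m] (mod 10 ^ m)"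
    using dvd[of m] by (simp add: power_10_dvd_of_nat_minus_iff cong_iff_dvd_diff)
  then have "int a mod 10 ^ m = residue y m" by (simp add: cong_def)
  then have sd: "10 ^ m * (s - d) = int a mod 10 ^ Suc m - residue y (Suc m)"
    using decimal_digit_minus_decadic_digit[of m a y] by (simp add: s_def d_def)
  have cong: "[10 ^ m * (s - d) = int a - residue y (Suc m)] (mod 10 ^ Suc m)"
    unfolding sd by (intro cong_diff) auto
  have "s \<noteq> d"
  proof
    assume "s = d"
    then have "10 ^ Suc m dvd int a - residue y (Suc m)"
      using cong_sym[OF cong] by (simp add: cong_0_iff del: power_Suc)
    then show False using dvd[of "Suc m"] unfolding power_10_dvd_of_nat_minus_iff by simp
  qed
  have five: "5 dvd s - d \<longleftrightarrow> u < w"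
  proof -
    have "5 ^ Suc m dvd int a - residue y (Suc m) \<longleftrightarrow> 5 ^ Suc m dvd 10 ^ m * (s - d)"
    proof (rule cong_dvd_iff[OF cong_sym])
      show "[10 ^ m * (s - d) = int a - residue y (Suc m)] (mod 5 ^ Suc m)"
        by (rule cong_dvd_modulus[OF cong], rule dvd_power_same) simp
    qed
    also have "(10::int) ^ m * (s - d) = 5 ^ m * (2 ^ m * (s - d))"
      by (simp flip: power_mult_distrib mult.assoc)
    also have "5 ^ Suc m dvd \<dots> \<longleftrightarrow> 5 dvd 2 ^ m * (s - d)" by (simp only: power_Suc2) simp
    also have "\<dots> \<longleftrightarrow> 5 dvd s - d" by (rule coprime_dvd_mult_right_iff) simp
    finally show ?thesis using dvd5[of "Suc m"] by (auto simp: m_def)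
  qed
  have "0 \<le> s" "s \<le> 9" by (simp_all add: s_def decimal_digit_bounds)
  moreover have "0 \<le> d" "d \<le> 9"
  proof -
    have "residue y (Suc m) div 10 ^ m < 10"
    proof (rule ccontr)
      assume "\<not> residue y (Suc m) div 10 ^ m < 10"
      then have "10 * 10 ^ m \<le> residue y (Suc m) div 10 ^ m * 10 ^ m" by (intro mult_right_mono) auto
      also have "\<dots> \<le> residue y (Suc m)"
        by (subst (2) div_mult_mod_eq[of _ "10 ^ m", symmetric]) simp
      finally show False using residue_less[of y "Suc m"] by simp
    qed
    then show "0 \<le> d" "d \<le> 9"
      by (simp_all add: d_def decadic_digit_def pos_imp_zdiv_nonneg_iff)
  qed
  \<comment> \<open>Distinct decimal digits differ by 1 to 9, and 5 is the only multiple of 5 in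
    that range.\<close>
  ultimately have "\<bar>s - d\<bar> = 5 \<longleftrightarrow> 5 dvd s - d" using \<open>s \<noteq> d\<close> by presburger
  then show ?digit
    using five key_digit_eqI[OF key] key_position_eqI[OF key] by (simp add: s_def d_def)
qed

text \<open>Of the factors \<open>x - 1\<close>, \<open>x + 1\<close> and \<open>x ^ 2 + 1\<close>
  of \<open>x ^ 4 - 1\<close>, exactly one is divisible by 5, and the class modulo 5 tells
  which.\<close>

lemma multiplicity_5_fourth_power:
  fixes x :: int
  shows "[x = 1] (mod 5) \<Longrightarrow> multiplicity 5 (x ^ 4 - 1) = multiplicity 5 (x - 1)"
    and "[x = 4] (mod 5) \<Longrightarrow> multiplicity 5 (x ^ 4 - 1) = multiplicity 5 (x + 1)"
    and "[x = 2] (mod 5) \<or> [x = 3] (mod 5) \<Longrightarrow> multiplicity 5 (x ^ 4 - 1) = multiplicity 5 (x\<^sup>2 + 1)"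
proof -
  have prime5: "prime (5 :: int)" by simp
  have factors: "x ^ 4 - 1 = (x - 1) * ((x + 1) * (x\<^sup>2 + 1))"
    "x ^ 4 - 1 = (x + 1) * ((x - 1) * (x\<^sup>2 + 1))" "x ^ 4 - 1 = (x\<^sup>2 + 1) * (x\<^sup>2 - 1)"
    by (simp_all add: algebra_simps eval_nat_numeral)
  show "multiplicity 5 (x ^ 4 - 1) = multiplicity 5 (x - 1)" if x: "[x = 1] (mod 5)"
  proof -
    have "[(x + 1) * (x\<^sup>2 + 1) = (1 + 1) * (1\<^sup>2 + 1)] (mod 5)"
      using x by (intro cong_mult cong_add cong_pow) auto
    then have "\<not> 5 dvd (x + 1) * (x\<^sup>2 + 1)" by (simp add: cong_dvd_iff)
    then show ?thesis unfolding factors(1) by (rule multiplicity_mult_not_dvd[OF prime5])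
  qed
  show "multiplicity 5 (x ^ 4 - 1) = multiplicity 5 (x + 1)" if x: "[x = 4] (mod 5)"
  proof -
    have "[(x - 1) * (x\<^sup>2 + 1) = (4 - 1) * (4\<^sup>2 + 1)] (mod 5)"
      using x by (intro cong_mult cong_add cong_diff cong_pow) auto
    then have "\<not> 5 dvd (x - 1) * (x\<^sup>2 + 1)" by (simp add: cong_dvd_iff)
    then show ?thesis unfolding factors(2) by (rule multiplicity_mult_not_dvd[OF prime5])
  qed
  show "multiplicity 5 (x ^ 4 - 1) = multiplicity 5 (x\<^sup>2 + 1)"
    if x: "[x = 2] (mod 5) \<or> [x = 3] (mod 5)"
  proof -
    have "[x\<^sup>2 - 1 = 2\<^sup>2 - 1] (mod 5) \<or> [x\<^sup>2 - 1 = 3\<^sup>2 - 1] (mod 5)"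
      using x by (meson cong_diff cong_pow cong_refl)
    then have "\<not> 5 dvd x\<^sup>2 - 1" by (auto simp: cong_dvd_iff)
    then show ?thesis unfolding factors(3) by (rule multiplicity_mult_not_dvd[OF prime5])
  qed
qed

text \<open>The key digit tells which valuation attains the minimum; in a tie the 5-adic one is as
  good.\<close>

lemma congruence_speed_key_digit:
  fixes a :: nat and y :: decadic
  assumes "a \<ge> 2" "y ^ 5 = y" "[int a = residue y 2] (mod 20)"
    and "\<epsilon> \<in> {1, -1}" "4 dvd int a - \<epsilon>" "\<not> 5 dvd a"
  shows "constant_congruence_speed a =
    Some (int (if \<bar>key_digit a y - decadic_digit y (key_position a y)\<bar> = 5
      then multiplicity 2 (int a - \<epsilon>) else multiplicity 5 (int a ^ 4 - 1)))"
proof -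
  have "odd (int a)" using assms(4,5) by (auto; presburger)
  then have "odd a" by simp
  then show ?thesis
    unfolding key_position_and_digit(2)[OF assms] congruence_speed_coprime_10[OF assms(1) \<open>odd a\<close> assms(6,4,5)]
    by (simp add: min_def)
qed

section \<open>The eight classes of units modulo 20\<close>

lemma coprime_10_residues:
  fixes a :: nat
  assumes "coprime a 10"
  shows "[a = 1] (mod 20) \<or> [a = 11] (mod 20) \<or> [a = 3] (mod 20) \<or> [a = 13] (mod 20) \<or>
    [a = 7] (mod 20) \<or> [a = 17] (mod 20) \<or> [a = 9] (mod 20) \<or> [a = 19] (mod 20)"
proof -
  have "\<not> 2 dvd a" "\<not> 5 dvd a"
    using assms coprime_common_divisor[of a 10 2] coprime_common_divisor[of a 10 5] by auto
  then show ?thesis by (simp add: cong_def) presburger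
qed

text \<open>The two final digits have to match \<open>r\<close> only modulo 20, as 51 does for 11.
  Forming a fourth root of unity modulo 25, they do belong to a solution.\<close>

lemma key_residue_cases:
  fixes a r :: nat and x1 x2 :: int
  assumes a: "[a = r] (mod 20)" "attached_decadic a = alpha x2 x1"
    and digits: "x1 \<in> {0..9}" "x2 \<in> {0..9}" "odd x1" "x1 \<noteq> 5" "25 dvd (10 * x2 + x1) ^ 4 - 1"
    and r: "[int r = 10 * x2 + x1] (mod 20)"
    and eps: "\<epsilon> \<in> {1, -1}" "4 dvd int r - \<epsilon>"
  shows "attached_decadic a ^ 5 = attached_decadic a"
    and "[int a = residue (attached_decadic a) 2] (mod 20)"
    and "4 dvd int a - \<epsilon>" and "\<not> 5 dvd a"
proof -
  note alpha = alpha_fifth_root[OF digits]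
  show "attached_decadic a ^ 5 = attached_decadic a" using alpha a(2) by simp
  have ar: "[int a = int r] (mod 20)" using a(1) by (metis cong_int_iff of_nat_numeral)
  then show "[int a = residue (attached_decadic a) 2] (mod 20)"
    unfolding a(2) alpha(2) using r by (rule cong_trans)
  have "[int a = int r] (mod 4)" by (rule cong_dvd_modulus[OF ar]) simp
  then show "4 dvd int a - \<epsilon>"
    using eps(2) unfolding cong_iff_dvd_diff[symmetric] by (rule cong_trans)
  have "[int a = x1] (mod 5)"
  proof -
    have "[int a = 10 * x2 + x1] (mod 5)" by (rule cong_dvd_modulus[OF cong_trans[OF ar r]]) simp
    moreover have "[10 * x2 + x1 = x1] (mod 5)" by (simp add: cong_iff_dvd_diff)
    ultimately show ?thesis by (rule cong_trans)
  qed
  moreover have "\<not> 5 dvd x1"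
  proof
    assume "5 dvd x1"
    then show False using digits(1,3,4) by (auto elim!: dvdE) presburger
  qed
  ultimately have "\<not> 5 dvd int a" by (simp add: cong_dvd_iff)
  then show "\<not> 5 dvd a" by presburger
qed

lemma attached_decadic_eq:
  "[a = 1] (mod 20) \<Longrightarrow> attached_decadic a = alpha 0 1"
  "[a = 11] (mod 20) \<Longrightarrow> attached_decadic a = alpha 5 1"
  "[a = 3] (mod 20) \<Longrightarrow> attached_decadic a = alpha 4 3"
  "[a = 13] (mod 20) \<Longrightarrow> attached_decadic a = alpha 9 3"
  "[a = 7] (mod 20) \<Longrightarrow> attached_decadic a = alpha 0 7"
  "[a = 17] (mod 20) \<Longrightarrow> attached_decadic a = alpha 5 7"
  "[a = 9] (mod 20) \<Longrightarrow> attached_decadic a = alpha 4 9"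
  "[a = 19] (mod 20) \<Longrightarrow> attached_decadic a = alpha 9 9"
  by (simp_all add: attached_decadic_def cong_def)

text \<open>\<open>ok\<close> bundles what the key-digit formula assumes about root and sign; the
  sign comes from the class modulo 4.\<close>

lemma attached_cases:
  fixes a :: nat
  defines "ok \<equiv> \<lambda>\<epsilon>. attached_decadic a ^ 5 = attached_decadic a \<and>
    [int a = residue (attached_decadic a) 2] (mod 20) \<and> \<epsilon> \<in> {1, -1} \<and> 4 dvd int a - \<epsilon> \<and> \<not> 5 dvd a"
  shows "[a = 1] (mod 20) \<Longrightarrow> ok 1" "[a = 11] (mod 20) \<Longrightarrow> ok (-1)"
    "[a = 3] (mod 20) \<Longrightarrow> ok (-1)" "[a = 13] (mod 20) \<Longrightarrow> ok 1"
    "[a = 7] (mod 20) \<Longrightarrow> ok (-1)" "[a = 17] (mod 20) \<Longrightarrow> ok 1"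
    "[a = 9] (mod 20) \<Longrightarrow> ok 1" "[a = 19] (mod 20) \<Longrightarrow> ok (-1)"
proof -
  have ok: "ok \<epsilon>" if "[a = r] (mod 20)" "attached_decadic a = alpha x2 x1" "\<epsilon> \<in> {1, -1}"
    "x1 \<in> {0..9}" "x2 \<in> {0..9}" "odd x1" "x1 \<noteq> 5" "25 dvd (10 * x2 + x1) ^ 4 - 1"
    "[int r = 10 * x2 + x1] (mod 20)" "4 dvd int r - \<epsilon>" for r x1 x2 \<epsilon>
    using key_residue_cases[OF that(1,2,4-9,3,10)] that(3) unfolding ok_def by blast
  show "[a = 1] (mod 20) \<Longrightarrow> ok 1"
    by (rule ok[of 1, OF _ attached_decadic_eq(1)]) (simp_all add: cong_def)
  show "[a = 11] (mod 20) \<Longrightarrow> ok (-1)"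
    by (rule ok[of 11, OF _ attached_decadic_eq(2)]) (simp_all add: cong_def)
  show "[a = 3] (mod 20) \<Longrightarrow> ok (-1)"
    by (rule ok[of 3, OF _ attached_decadic_eq(3)]) (simp_all add: cong_def)
  show "[a = 13] (mod 20) \<Longrightarrow> ok 1"
    by (rule ok[of 13, OF _ attached_decadic_eq(4)]) (simp_all add: cong_def)
  show "[a = 7] (mod 20) \<Longrightarrow> ok (-1)"
    by (rule ok[of 7, OF _ attached_decadic_eq(5)]) (simp_all add: cong_def)
  show "[a = 17] (mod 20) \<Longrightarrow> ok 1"
    by (rule ok[of 17, OF _ attached_decadic_eq(6)]) (simp_all add: cong_def)
  show "[a = 9] (mod 20) \<Longrightarrow> ok 1"
    by (rule ok[of 9, OF _ attached_decadic_eq(7)]) (simp_all add: cong_def)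
  show "[a = 19] (mod 20) \<Longrightarrow> ok (-1)"
    by (rule ok[of 19, OF _ attached_decadic_eq(8)]) (simp_all add: cong_def)
qed

lemma coprime_10_attached:
  assumes "coprime a 10"
  obtains \<epsilon> where "attached_decadic a ^ 5 = attached_decadic a"
    "[int a = residue (attached_decadic a) 2] (mod 20)" "\<epsilon> \<in> {1, -1}" "4 dvd int a - \<epsilon>" "\<not> 5 dvd a"
  using coprime_10_residues[OF assms] attached_cases[of a] by metis

section \<open>Final digits of no solution, and numbers without a value\<close>

text \<open>If 25 divided \<open>a ^ 4 - 1\<close>, then \<open>a\<close> would agree with its
  attached root modulo 100, and that root would end in the digits of \<open>a\<close>. So the 5-adic
  slope is exactly 1, and the 2-adic one is not smaller.\<close>

lemma congruence_speed_no_root: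
  assumes "coprime a 10"
    and "\<nexists>y :: decadic. y ^ 5 = y \<and> decadic_digit y 2 = decimal_digit a 2 \<and>
      decadic_digit y 1 = decimal_digit a 1"
  shows "constant_congruence_speed a = Some 1"
proof -
  define y where "y = attached_decadic a"
  obtain \<epsilon> where y: "y ^ 5 = y" "[int a = residue y 2] (mod 20)"
    and eps: "\<epsilon> \<in> {1, -1}" "4 dvd int a - \<epsilon>" and not5: "\<not> 5 dvd a"
    using coprime_10_attached[OF assms(1)] unfolding y_def by metis
  have not5': "\<not> 5 dvd int a" using not5 by presburger
  have "odd (int a)" using eps by (auto; presburger)
  then have "odd a" by simp
  \<comment> \<open>The decadic 1 is itself a solution and ends in the digits 01.\<close>
  have "a \<noteq> 1"
  proof
    assume "a = 1"
    then have "(1 :: decadic) ^ 5 = 1 \<and> decadic_digit 1 2 = decimal_digit a 2 \<and>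
        decadic_digit 1 1 = decimal_digit a 1"
      by (simp add: decadic_digit_def decimal_digit_def one_decadic.rep_eq)
    then show False using assms(2) by blast
  qed
  then have a: "a \<ge> 2" using \<open>odd a\<close> by presburger
  have "\<not> 5 ^ 2 dvd int a ^ 4 - 1"
  proof
    assume "5 ^ 2 dvd int a ^ 4 - 1"
    then have "10 ^ 2 dvd int a - residue y 2"
      unfolding power_10_dvd_iff using fifth_root_dvd_iffs[OF y eps not5', of 2] eps(2) by simp
    then have "int a mod 10 ^ 2 = residue y 2 mod 10 ^ 2" by (simp only: mod_eq_dvd_iff)
    then have "int a mod 10 ^ 2 = residue y 2" by (simp only: residue_mod)
    then have "int (a mod 100) = residue y 2" by (simp add: zmod_int)
    then have "decadic_digit y 1 = int (a mod 100 mod 10)" "decadic_digit y 2 = int (a mod 100 div 10)"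
      unfolding decadic_digit_1_2 by (metis of_nat_numeral zmod_int, metis of_nat_numeral zdiv_int)
    moreover have "a mod 100 mod 10 = a mod 10" by (simp add: mod_mod_cancel)
    moreover have "a mod 100 div 10 = a div 10 mod 10"
      using mod_mult2_eq[of a 10 10] by simp
    ultimately show False using assms(2) y(1) by (auto simp: decimal_digit_def)
  qed
  moreover have "5 ^ 1 dvd int a ^ 4 - 1"
    using five_dvd_fourth_power_minus_one[OF not5'] by simp
  ultimately have "multiplicity 5 (int a ^ 4 - 1) = 1"
    by (intro multiplicity_eqI) (simp_all add: power2_eq_square)
  moreover have "2 ^ 1 dvd int a - \<epsilon>" using dvd_trans[of 2 4, OF _ eps(2)] by simp
  then have "multiplicity 2 (int a - \<epsilon>) \<ge> 1" using a eps(1) by (intro multiplicity_geI) auto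
  ultimately show ?thesis
    using congruence_speed_coprime_10[OF a \<open>odd a\<close> not5 eps] by simp
qed

lemma constant_congruence_speed_eq_None_iff:
  "constant_congruence_speed a = None \<longleftrightarrow> [a = 0] (mod 10) \<and> a \<noteq> 0"
proof (cases "a \<le> 1")
  case True
  then have "a = 0 \<or> a = 1" by linarith
  then show ?thesis by (auto simp: constant_congruence_speed_def cong_def)
next
  case False
  then have a: "a \<ge> 2" by simp
  have ten: "[a = 0] (mod 10) \<longleftrightarrow> even a \<and> 5 dvd a"
    by (simp add: cong_0_iff) presburger
  consider "[a = 0] (mod 10)" | "even a" "\<not> 5 dvd a" | "odd a"
    using ten by blast
  then show ?thesis
  proof cases
    case 1
    then show ?thesis using congruence_speed_multiple_of_10[of a] a by (simp add: cong_0_iff)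
  next
    case 2
    then show ?thesis using congruence_speed_even[OF a] ten by simp
  next
    case 3
    then have "odd (int a)" by simp
    then obtain \<epsilon> where "\<epsilon> \<in> {1, -1}" "4 dvd int a - \<epsilon>" using odd_int_cong_unit_mod_4 by blast
    then show ?thesis
      using 3 ten congruence_speed_odd_multiple_of_5[of a \<epsilon>] congruence_speed_coprime_10[OF a, of \<epsilon>]
      by (cases "5 dvd a") auto
  qed
qed

section \<open>Assembly of all residue classes\<close>

lemma multiplicity_5_fourth_power_nat:
  fixes a :: nat
  shows "[a = 1] (mod 5) \<Longrightarrow> multiplicity 5 (int a ^ 4 - 1) = multiplicity 5 (int a - 1)"
    and "[a = 4] (mod 5) \<Longrightarrow> multiplicity 5 (int a ^ 4 - 1) = multiplicity 5 (int a + 1)"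
    and "[a = 2] (mod 5) \<Longrightarrow> multiplicity 5 (int a ^ 4 - 1) = multiplicity 5 ((int a)\<^sup>2 + 1)"
    and "[a = 3] (mod 5) \<Longrightarrow> multiplicity 5 (int a ^ 4 - 1) = multiplicity 5 ((int a)\<^sup>2 + 1)"
  using multiplicity_5_fourth_power[of "int a"] by (simp_all flip: cong_int_iff)

theorem mainTheorem6:
  fixes a l :: nat and s :: int
  assumes "l = key_position a (attached_decadic a)"
    and "s = key_digit a (attached_decadic a)"
  shows
   "(a \<in> {0, 1} \<longrightarrow> constant_congruence_speed a = Some 0) \<and>
    ([a = 2] (mod 10) \<or> [a = 8] (mod 10) \<longrightarrow>
      constant_congruence_speed a = Some (int (multiplicity 5 ((int a)\<^sup>2 + 1)))) \<and>
    ([a = 4] (mod 10) \<longrightarrow>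
      constant_congruence_speed a = Some (int (multiplicity 5 (int a + 1)))) \<and>
    ([a = 6] (mod 10) \<longrightarrow>
      constant_congruence_speed a = Some (int (multiplicity 5 (int a - 1)))) \<and>
    ([a = 5] (mod 20) \<longrightarrow>
      constant_congruence_speed a = Some (int (multiplicity 2 (int a - 1)))) \<and>
    ([a = 15] (mod 20) \<longrightarrow>
      constant_congruence_speed a = Some (int (multiplicity 2 (int a + 1)))) \<and>
    ([a = 1] (mod 20) \<and> s \<noteq> 5 \<and> a \<noteq> 1 \<longrightarrow>
      constant_congruence_speed a = Some (int (multiplicity 5 (int a - 1)))) \<and>
    ([a = 1] (mod 20) \<and> s = 5 \<longrightarrow>
      constant_congruence_speed a = Some (int (multiplicity 2 (int a - 1)))) \<and>
    ([a = 11] (mod 20) \<and> \<bar>s - decadic_digit (alpha 5 1) l\<bar> \<noteq> 5 \<longrightarrow>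
      constant_congruence_speed a = Some (int (multiplicity 5 (int a - 1)))) \<and>
    ([a = 11] (mod 20) \<and> \<bar>s - decadic_digit (alpha 5 1) l\<bar> = 5 \<longrightarrow>
      constant_congruence_speed a = Some (int (multiplicity 2 (int a + 1)))) \<and>
    ([a = 3] (mod 20) \<and> \<bar>s - decadic_digit (alpha 4 3) l\<bar> \<noteq> 5 \<longrightarrow>
      constant_congruence_speed a = Some (int (multiplicity 5 ((int a)\<^sup>2 + 1)))) \<and>
    ([a = 3] (mod 20) \<and> \<bar>s - decadic_digit (alpha 4 3) l\<bar> = 5 \<longrightarrow>
      constant_congruence_speed a = Some (int (multiplicity 2 (int a + 1)))) \<and>
    ([a = 13] (mod 20) \<and> \<bar>s - decadic_digit (alpha 9 3) l\<bar> \<noteq> 5 \<longrightarrow>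
      constant_congruence_speed a = Some (int (multiplicity 5 ((int a)\<^sup>2 + 1)))) \<and>
    ([a = 13] (mod 20) \<and> \<bar>s - decadic_digit (alpha 9 3) l\<bar> = 5 \<longrightarrow>
      constant_congruence_speed a = Some (int (multiplicity 2 (int a - 1)))) \<and>
    ([a = 7] (mod 20) \<and> \<bar>s - decadic_digit (alpha 0 7) l\<bar> \<noteq> 5 \<longrightarrow>
      constant_congruence_speed a = Some (int (multiplicity 5 ((int a)\<^sup>2 + 1)))) \<and>
    ([a = 7] (mod 20) \<and> \<bar>s - decadic_digit (alpha 0 7) l\<bar> = 5 \<longrightarrow>
      constant_congruence_speed a = Some (int (multiplicity 2 (int a + 1)))) \<and>
    ([a = 17] (mod 20) \<and> \<bar>s - decadic_digit (alpha 5 7) l\<bar> \<noteq> 5 \<longrightarrow>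
      constant_congruence_speed a = Some (int (multiplicity 5 ((int a)\<^sup>2 + 1)))) \<and>
    ([a = 17] (mod 20) \<and> \<bar>s - decadic_digit (alpha 5 7) l\<bar> = 5 \<longrightarrow>
      constant_congruence_speed a = Some (int (multiplicity 2 (int a - 1)))) \<and>
    ([a = 9] (mod 20) \<and> \<bar>s - decadic_digit (alpha 4 9) l\<bar> \<noteq> 5 \<longrightarrow>
      constant_congruence_speed a = Some (int (multiplicity 5 (int a + 1)))) \<and>
    ([a = 9] (mod 20) \<and> \<bar>s - decadic_digit (alpha 4 9) l\<bar> = 5 \<longrightarrow>
      constant_congruence_speed a = Some (int (multiplicity 2 (int a - 1)))) \<and>
    ([a = 19] (mod 20) \<and> s \<noteq> 4 \<longrightarrow>
      constant_congruence_speed a = Some (int (multiplicity 5 (int a + 1)))) \<and>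
    ([a = 19] (mod 20) \<and> s = 4 \<longrightarrow>
      constant_congruence_speed a = Some (int (multiplicity 2 (int a + 1)))) \<and>
    (constant_congruence_speed a = None \<longleftrightarrow> [a = 0] (mod 10) \<and> a \<noteq> 0) \<and>
    (a < 10 \<longrightarrow> decimal_digit a 2 = 0) \<and>
    (a < 10 \<and> coprime a 10 \<longrightarrow> s = 0) \<and>
    (coprime a 10 \<and>
     (\<nexists>y :: decadic. y ^ 5 = y \<and> decadic_digit y 2 = decimal_digit a 2 \<and>
        decadic_digit y 1 = decimal_digit a 1) \<longrightarrow>
      constant_congruence_speed a = Some 1)"
proof -
  let ?V = "constant_congruence_speed a"
  let ?y = "attached_decadic a"
  note five = multiplicity_5_fourth_power_nat[of a]
  have ge2: "a \<ge> 2" if "[a = r] (mod m)" "r \<ge> 2" "r < m" for r m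
    using that mod_less_eq_dividend[of a m] by (simp add: cong_def)
  have mod5: "[a = r mod 5] (mod 5)" if "[a = r] (mod m)" "5 dvd m" for r m
    using cong_dvd_modulus_nat[OF that] by (simp add: cong_def)
  have even: "?V = Some (int (multiplicity 5 (int a ^ 4 - 1)))"
    if "[a = r] (mod 10)" "r \<in> {2, 4, 6, 8}" for r
  proof (rule congruence_speed_even)
    have "a mod 10 = 2 \<or> a mod 10 = 4 \<or> a mod 10 = 6 \<or> a mod 10 = 8"
      using that by (auto simp: cong_def)
    then show "a \<ge> 2" "even a" "\<not> 5 dvd a" by presburger+
  qed
  have key: "(\<bar>s - decadic_digit y l\<bar> \<noteq> 5 \<longrightarrow> ?V = Some (int (multiplicity 5 (int a ^ 4 - 1)))) \<and>
      (\<bar>s - decadic_digit y l\<bar> = 5 \<longrightarrow> ?V = Some (int (multiplicity 2 (int a - \<epsilon>))))"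
    if "a \<ge> 2" "?y = y" "?y ^ 5 = ?y \<and> [int a = residue ?y 2] (mod 20) \<and>
      \<epsilon> \<in> {1, -1} \<and> 4 dvd int a - \<epsilon> \<and> \<not> 5 dvd a" for y \<epsilon>
    using congruence_speed_key_digit[of a ?y \<epsilon>] that assms by simp
  have l2: "l \<ge> 2" if "a \<ge> 2" "?y ^ 5 = ?y \<and> [int a = residue ?y 2] (mod 20) \<and>
      \<epsilon> \<in> {1, -1} \<and> 4 dvd int a - \<epsilon> \<and> \<not> 5 dvd a" for \<epsilon>
    using key_position_and_digit(3)[of a ?y \<epsilon>] that assms(1) by simp
  have s: "0 \<le> s" "s \<le> 9" using key_digit_bounds assms(2) by simp_all
  have case_1: "(\<bar>s - decadic_digit (alpha 0 1) l\<bar> \<noteq> 5 \<longrightarrow> ?V = Some (int (multiplicity 5 (int a - 1)))) \<and>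
      (\<bar>s - decadic_digit (alpha 0 1) l\<bar> = 5 \<longrightarrow> ?V = Some (int (multiplicity 2 (int a - 1))))"
    if a: "[a = 1] (mod 20)" and "a \<ge> 2"
    using key[OF \<open>a \<ge> 2\<close> attached_decadic_eq(1)[OF a] attached_cases(1)[OF a]]
      five(1) mod5[OF a] by simp
  have case_11: "(\<bar>s - decadic_digit (alpha 5 1) l\<bar> \<noteq> 5 \<longrightarrow> ?V = Some (int (multiplicity 5 (int a - 1)))) \<and>
      (\<bar>s - decadic_digit (alpha 5 1) l\<bar> = 5 \<longrightarrow> ?V = Some (int (multiplicity 2 (int a + 1))))"
    if a: "[a = 11] (mod 20)"
    using key[OF ge2[OF a, simplified] attached_decadic_eq(2)[OF a] attached_cases(2)[OF a]]
      five(1) mod5[OF a] by simp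
  have case_3: "(\<bar>s - decadic_digit (alpha 4 3) l\<bar> \<noteq> 5 \<longrightarrow> ?V = Some (int (multiplicity 5 ((int a)\<^sup>2 + 1)))) \<and>
      (\<bar>s - decadic_digit (alpha 4 3) l\<bar> = 5 \<longrightarrow> ?V = Some (int (multiplicity 2 (int a + 1))))"
    if a: "[a = 3] (mod 20)"
    using key[OF ge2[OF a, simplified] attached_decadic_eq(3)[OF a] attached_cases(3)[OF a]]
      five(4) mod5[OF a] by simp
  have case_13: "(\<bar>s - decadic_digit (alpha 9 3) l\<bar> \<noteq> 5 \<longrightarrow> ?V = Some (int (multiplicity 5 ((int a)\<^sup>2 + 1)))) \<and>
      (\<bar>s - decadic_digit (alpha 9 3) l\<bar> = 5 \<longrightarrow> ?V = Some (int (multiplicity 2 (int a - 1))))"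
    if a: "[a = 13] (mod 20)"
    using key[OF ge2[OF a, simplified] attached_decadic_eq(4)[OF a] attached_cases(4)[OF a]]
      five(4) mod5[OF a] by simp
  have case_7: "(\<bar>s - decadic_digit (alpha 0 7) l\<bar> \<noteq> 5 \<longrightarrow> ?V = Some (int (multiplicity 5 ((int a)\<^sup>2 + 1)))) \<and>
      (\<bar>s - decadic_digit (alpha 0 7) l\<bar> = 5 \<longrightarrow> ?V = Some (int (multiplicity 2 (int a + 1))))"
    if a: "[a = 7] (mod 20)"
    using key[OF ge2[OF a, simplified] attached_decadic_eq(5)[OF a] attached_cases(5)[OF a]]
      five(3) mod5[OF a] by simp
  have case_17: "(\<bar>s - decadic_digit (alpha 5 7) l\<bar> \<noteq> 5 \<longrightarrow> ?V = Some (int (multiplicity 5 ((int a)\<^sup>2 + 1)))) \<and>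
      (\<bar>s - decadic_digit (alpha 5 7) l\<bar> = 5 \<longrightarrow> ?V = Some (int (multiplicity 2 (int a - 1))))"
    if a: "[a = 17] (mod 20)"
    using key[OF ge2[OF a, simplified] attached_decadic_eq(6)[OF a] attached_cases(6)[OF a]]
      five(3) mod5[OF a] by simp
  have case_9: "(\<bar>s - decadic_digit (alpha 4 9) l\<bar> \<noteq> 5 \<longrightarrow> ?V = Some (int (multiplicity 5 (int a + 1)))) \<and>
      (\<bar>s - decadic_digit (alpha 4 9) l\<bar> = 5 \<longrightarrow> ?V = Some (int (multiplicity 2 (int a - 1))))"
    if a: "[a = 9] (mod 20)"
    using key[OF ge2[OF a, simplified] attached_decadic_eq(7)[OF a] attached_cases(7)[OF a]]
      five(2) mod5[OF a] by simp
  have case_19: "(\<bar>s - decadic_digit (alpha 9 9) l\<bar> \<noteq> 5 \<longrightarrow> ?V = Some (int (multiplicity 5 (int a + 1)))) \<and>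
      (\<bar>s - decadic_digit (alpha 9 9) l\<bar> = 5 \<longrightarrow> ?V = Some (int (multiplicity 2 (int a + 1))))"
    if a: "[a = 19] (mod 20)"
    using key[OF ge2[OF a, simplified] attached_decadic_eq(8)[OF a] attached_cases(8)[OF a]]
      five(2) mod5[OF a] by simp
  \<comment> \<open>The attached root is 1, whose digits from position 2 on are 0, so the key digit
    differs from it by 5 only if it is 5.\<close>
  have case_1': "(s \<noteq> 5 \<longrightarrow> ?V = Some (int (multiplicity 5 (int a - 1)))) \<and>
      (s = 5 \<longrightarrow> ?V = Some (int (multiplicity 2 (int a - 1))))"
    if a: "[a = 1] (mod 20)" "a \<noteq> 1"
  proof -
    have a2: "a \<ge> 2" using a by (cases "a = 0") (auto simp: cong_def)
    have "decadic_digit (alpha 0 1) l = 0"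
      using decadic_digit_one[OF l2[OF a2 attached_cases(1)[OF a(1)]]] by (simp add: alpha_01)
    then show ?thesis using case_1[OF a(1) a2] s by (cases "s = 5") auto
  qed
  \<comment> \<open>The attached root is -1 with all digits 9; a digit differs from 9 by 5 only if
    it is 4.\<close>
  have case_19': "(s \<noteq> 4 \<longrightarrow> ?V = Some (int (multiplicity 5 (int a + 1)))) \<and>
      (s = 4 \<longrightarrow> ?V = Some (int (multiplicity 2 (int a + 1))))"
    if a: "[a = 19] (mod 20)"
  proof -
    have "l \<ge> 2" by (rule l2[OF _ attached_cases(8)[OF a]]) (rule ge2[OF a], simp_all)
    then have "decadic_digit (alpha 9 9) l = 9" by (simp add: alpha_99 decadic_digit_minus_one)
    then show ?thesis using case_19[OF a] s by (cases "s = 4") auto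
  qed
  have five_mult: "?V = Some (int (multiplicity 2 (int a - \<epsilon>)))"
    if "[a = r] (mod 20)" "(r, \<epsilon>) \<in> {(5, 1), (15, -1)}" for r \<epsilon>
  proof (rule congruence_speed_odd_multiple_of_5)
    have "a mod 20 = 5 \<and> \<epsilon> = 1 \<or> a mod 20 = 15 \<and> \<epsilon> = -1" using that by (auto simp: cong_def)
    then show "odd a" "5 dvd a" "\<epsilon> \<in> {1, -1}" "4 dvd int a - \<epsilon>"
      by (presburger, presburger, blast, presburger)
  qed
  show ?thesis
  proof (intro conjI impI, goal_cases)
    case 1
    then show ?case by (auto simp: constant_congruence_speed_def)
  next
    case 2
    then show ?case using even[of 2] even[of 8] five(3,4) mod5[of 2 10] mod5[of 8 10] by auto
  next
    case 3
    then show ?case using even[of 4] five(2) mod5[of 4 10] by simp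
  next
    case 4
    then show ?case using even[of 6] five(1) mod5[of 6 10] by simp
  next
    case 5
    then show ?case using five_mult[of 5 1] by simp
  next
    case 6
    then show ?case using five_mult[of 15 "-1"] by simp
  next
    case 7
    then show ?case using case_1' by simp
  next
    case 8
    \<comment> \<open>For \<open>a = 1\<close> the key digit is 0 by convention, so
      \<open>s = 5\<close> excludes this case.\<close>
    then have "a \<noteq> 1" using key_digit_eq_0[of a] assms(2) by auto
    then show ?case using 8 case_1' by simp
  next
    case 9
    then show ?case using case_11 by simp
  next
    case 10
    then show ?case using case_11 by simp
  next
    case 11
    then show ?case using case_3 by simp
  next
    case 12
    then show ?case using case_3 by simp
  next
    case 13
    then show ?case using case_13 by simp
  next
    case 14
    then show ?case using case_13 by simp
  next
    case 15
    then show ?case using case_7 by simp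
  next
    case 16
    then show ?case using case_7 by simp
  next
    case 17
    then show ?case using case_17 by simp
  next
    case 18
    then show ?case using case_17 by simp
  next
    case 19
    then show ?case using case_9 by simp
  next
    case 20
    then show ?case using case_9 by simp
  next
    case 21
    then show ?case using case_19' by simp
  next
    case 22
    then show ?case using case_19' by simp
  next
    case 23
    then show ?case using constant_congruence_speed_eq_None_iff by simp
  next
    case 24
    then show ?case using decimal_digit_eq_0 by simp
  next
    case 25
    then show ?case using key_digit_eq_0 assms(2) by simp
  next
    case 26
    then show ?case using congruence_speed_no_root by simp
  qed
qed

end
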